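(* Let $d\ge2$ be an integer, let $L\in\mathbb{N}_0$, and let $\phi\colon[0,\infty)\to[0,\infty)$ be a continuous function with $\phi(t)>0$ for $0\le t\le\frac12$ and $\phi(t)=0$ for $t\ge1$. There is a constant $r>0$, depending only on $d$, $L$ and $\phi$, such that the following holds. Let $f\in C^{L+1}(\mathbb{S}^{d-1})$, let $c>0$, and let $\big(Y^\ell=\{y_1^\ell,\dots,y_{N_\ell}^\ell\}\big)_{\ell\in\mathbb{N}}$ be a family of node sets in $\mathbb{S}^{d-1}$ with fill distances $h_\ell$ and separation distances $q_\ell$ such that $h_\ell/q_\ell\le c$ for all $\ell\in\mathbb{N}$ and $h_\ell\to0$ as $\ell\to\infty$. Choose $R\ge r$, set $\delta_\ell:=R\,h_\ell$ and $w_\ell(y,z):=\phi\big(d(y,z)/\delta_\ell\big)$ for $y,z\in\mathbb{S}^{d-1}$. For $y\in\mathbb{S}^{d-1}$ let $f^\ell(y):=\mathcal{M}f(y)$ be the moving least squares (MLS) approximation of $f$ in $y$ with respect to the nodes $Y^\ell$, the weight function $w_\ell$ and the ansatz space of polynomials on the tangent space $$\widetilde{\mathcal{P}}_L(\mathbb{R}^{d-1},\pi,y)=\big\{p\circ\pi^{-1}\circ \mathbf{R}_y : p\in\mathcal{P}_L(\mathbb{R}^{d-1})\big\},$$ where $\mathbf{R}_y\in\mathcal{SO}(d)$ is a rotation matrix with $\mathbf{R}_y y=e_d$. Then $$\|f-f^\ell\|_\infty=\mathcal{O}\big(h_\ell^{L+1}\big)\qquad\text{as }\ell\to\infty .$$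
   Context: $\mathbb{S}^{d-1}=\{y\in\mathbb{R}^d : \|y\|_2=1\}$, $e_d=(0,\dots,0,1)$, with great circle distance $d(y,z)=\arccos(\langle y,z\rangle)$ and open caps $C_\delta(y)=\{z\in\mathbb{S}^{d-1}: d(y,z)<\delta\}$. Functions take values in $\mathbb{K}\in\{\mathbb{R},\mathbb{C}\}$, and all polynomial and function spaces are linear over the field $\mathbb{K}$ that $f$ maps into. $\|g\|_\infty=\sup_{y\in\mathbb{S}^{d-1}}|g(y)|$. $\mathcal{SO}(d)$ is the group of rotation matrices of $\mathbb{R}^d$. $\mathcal{P}_L(\mathbb{R}^{d-1})$ is the space of polynomials on $\mathbb{R}^{d-1}$ of total degree at most $L$. The projection $\pi\colon B_1(0)\to C_{\pi/2}(e_d)$, with $B_1(0)\subset\mathbb{R}^{d-1}$ the open unit ball, is $\pi(x_1,\dots,x_{d-1})=(x_1,\dots,x_{d-1},\sqrt{1-\|x\|_2^2})$, with inverse $\pi^{-1}(y_1,\dots,y_d)=(y_1,\dots,y_{d-1})$ on $C_{\pi/2}(e_d)$. Functions in $\widetilde{\mathcal{P}}_L(\mathbb{R}^{d-1},\pi,y)$ are defined on $C_{\pi/2}(y)$; this space depends only on $\mathbf{R}_y y=e_d$ and not on the particular choice of $\mathbf{R}_y$. For distinct nodes $y_1,\dots,y_N\in\mathbb{S}^{d-1}$ ($N\ge2$) the fill distance is $h=\sup_{y\in\mathbb{S}^{d-1}}\min_i d(y_i,y)$ and the separation distance is $q=\frac12\min_{i\ne j}d(y_i,y_j)$. MLS approximation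 with polynomials on the tangent space: given nodes $y_1,\dots,y_N$, a center $y$ and a weight function $w\colon\mathbb{S}^{d-1}\times\mathbb{S}^{d-1}\to[0,\infty)$ such that the problem $\min_{p\in\mathcal{P}_L(\mathbb{R}^{d-1})}\sum_{w(y_i,y)>0}w(y_i,y)\,|f(y_i)-p\circ\pi^{-1}\circ\mathbf{R}_y(y_i)|^2$ possesses a unique solution $p_y$, the MLS approximation of $f$ in $y$ is $\mathcal{M}f(y):=p_y(0)$. (Unique solvability is part of the definition; nodes with positive weight lie in $C_{\pi/2}(y)$ as soon as $\delta_\ell\le\pi/2$.) *)

theory Defs
  imports "HOL-Analysis.Analysis" "HOL-Library.Landau_Symbols"
begin

text \<open>
  The dimension is \<open>d = CARD('n) + 1\<close>, which is at least 2 and otherwise arbitrary: \<open>real ^ 'n\<close> is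
  the space of dimension \<open>d - 1\<close> and \<open>real ^ ('n option)\<close> the ambient space of dimension \<open>d\<close>,
  whose last coordinate is the one with index \<open>None\<close>.
\<close>

type_synonym 'n ambient = "real ^ ('n option)"

definition north :: "'n::finite ambient" where
  "north = axis None 1"

definition gdist :: "'n::finite ambient \<Rightarrow> 'n ambient \<Rightarrow> real" where
  "gdist y z = arccos (y \<bullet> z)"

definition cap :: "'n::finite ambient \<Rightarrow> real \<Rightarrow> 'n ambient set" where
  "cap y \<delta> = {z \<in> sphere 0 1. gdist y z < \<delta>}"

definition fill_dist :: "'n::finite ambient set \<Rightarrow> real" where
  "fill_dist Y = (SUP y\<in>sphere 0 1. Min ((\<lambda>z. gdist z y) ` Y))"

definition sep_dist :: "'n::finite ambient set \<Rightarrow> real" where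
  "sep_dist Y = 1 / 2 * Min {gdist y z |y z. y \<in> Y \<and> z \<in> Y \<and> y \<noteq> z}"

definition node_set :: "'n::finite ambient set \<Rightarrow> bool" where
  "node_set Y \<longleftrightarrow> finite Y \<and> 2 \<le> card Y \<and> Y \<subseteq> sphere 0 1"

definition sphere_proj :: "real ^ 'n \<Rightarrow> 'n::finite ambient" where
  "sphere_proj x = (\<chi> i. case i of None \<Rightarrow> sqrt (1 - (norm x)\<^sup>2) | Some j \<Rightarrow> x $ j)"

text \<open>
  \<open>sphere_proj\<close> maps \<open>ball 0 1\<close> onto \<open>cap north (pi / 2)\<close>; the following is its inverse there and
  is only meaningful on that cap.
\<close>

definition sphere_proj_inv :: "'n::finite ambient \<Rightarrow> real ^ 'n" where
  "sphere_proj_inv y = (\<chi> j. y $ Some j)"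

text \<open>Polynomial functions of total degree at most \<open>L\<close>; \<open>\<alpha>\<close> ranges over multi-indices.\<close>

definition polys :: "nat \<Rightarrow> (real ^ 'n::finite \<Rightarrow> 'k::real_normed_field) set" where
  "polys L = {p. \<exists>c :: ('n \<Rightarrow> nat) \<Rightarrow> 'k. \<forall>x.
     p x = (\<Sum>\<alpha> | (\<Sum>i\<in>UNIV. \<alpha> i) \<le> L. c \<alpha> * (\<Prod>i\<in>UNIV. of_real (x $ i) ^ \<alpha> i))}"

text \<open>\<open>k\<close> times continuously differentiable on an open set \<open>S\<close>.\<close>

primrec Ck_on :: "nat \<Rightarrow> 'a::real_normed_vector set \<Rightarrow> ('a \<Rightarrow> 'b::real_normed_vector) \<Rightarrow> bool" where
  "Ck_on 0 S f \<longleftrightarrow> continuous_on S f"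
| "Ck_on (Suc k) S f \<longleftrightarrow> (\<forall>x\<in>S. f differentiable (at x)) \<and>
     (\<forall>v. Ck_on k S (\<lambda>x. frechet_derivative f (at x) v))"

text \<open>
  Smoothness on the sphere as a manifold: the maps \<open>\<lambda>x. A *v sphere_proj x\<close> on \<open>ball 0 1\<close>, with \<open>A\<close>
  a rotation, parametrize the open half spheres and are the inverse charts of an atlas.
\<close>

definition Ck_sphere :: "nat \<Rightarrow> ('n::finite ambient \<Rightarrow> 'b::real_normed_vector) \<Rightarrow> bool" where
  "Ck_sphere k f \<longleftrightarrow>
     (\<forall>A. rotation_matrix A \<longrightarrow> Ck_on k (ball 0 1) (\<lambda>x. f (A *v sphere_proj x)))"

definition rotation_field :: "('n::finite ambient \<Rightarrow> real ^ ('n option) ^ ('n option)) \<Rightarrow> bool" where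
  "rotation_field Rot \<longleftrightarrow> (\<forall>y\<in>sphere 0 1. rotation_matrix (Rot y) \<and> Rot y *v y = north)"

text \<open>
  The MLS problem at the center \<open>y\<close>, for nodes \<open>Y\<close>, a weight function \<open>w\<close> and a rotation \<open>A\<close>
  taking \<open>y\<close> to \<open>north\<close>.
\<close>

definition mls_error ::
  "('n::finite ambient \<Rightarrow> 'k::real_normed_field) \<Rightarrow> 'n ambient set \<Rightarrow>
   ('n ambient \<Rightarrow> 'n ambient \<Rightarrow> real) \<Rightarrow> real ^ ('n option) ^ ('n option) \<Rightarrow> 'n ambient \<Rightarrow>
   (real ^ 'n \<Rightarrow> 'k) \<Rightarrow> real" where
  "mls_error f Y w A y p =
     (\<Sum>z \<in> {z \<in> Y. w z y > 0}. w z y * (norm (f z - p (sphere_proj_inv (A *v z))))\<^sup>2)"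

definition mls_minimizer ::
  "nat \<Rightarrow> ('n::finite ambient \<Rightarrow> 'k::real_normed_field) \<Rightarrow> 'n ambient set \<Rightarrow>
   ('n ambient \<Rightarrow> 'n ambient \<Rightarrow> real) \<Rightarrow> real ^ ('n option) ^ ('n option) \<Rightarrow> 'n ambient \<Rightarrow>
   (real ^ 'n \<Rightarrow> 'k) \<Rightarrow> bool" where
  "mls_minimizer L f Y w A y p \<longleftrightarrow> is_arg_min (mls_error f Y w A y) (\<lambda>p. p \<in> polys L) p"

text \<open>
  The MLS approximation exists at \<open>y\<close> if every node of positive weight lies in the cap on which the
  ansatz functions are defined and the minimization problem has a unique solution.
\<close>

definition mls_defined ::
  "nat \<Rightarrow> ('n::finite ambient \<Rightarrow> 'k::real_normed_field) \<Rightarrow> 'n ambient set \<Rightarrow>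
   ('n ambient \<Rightarrow> 'n ambient \<Rightarrow> real) \<Rightarrow> real ^ ('n option) ^ ('n option) \<Rightarrow> 'n ambient \<Rightarrow> bool" where
  "mls_defined L f Y w A y \<longleftrightarrow>
     (\<forall>z\<in>Y. w z y > 0 \<longrightarrow> z \<in> cap y (pi / 2)) \<and> (\<exists>!p. mls_minimizer L f Y w A y p)"

definition mls ::
  "nat \<Rightarrow> ('n::finite ambient \<Rightarrow> 'k::real_normed_field) \<Rightarrow> 'n ambient set \<Rightarrow>
   ('n ambient \<Rightarrow> 'n ambient \<Rightarrow> real) \<Rightarrow> real ^ ('n option) ^ ('n option) \<Rightarrow> 'n ambient \<Rightarrow> 'k" where
  "mls L f Y w A y = (THE p. mls_minimizer L f Y w A y p) 0"

text \<open>
  The supremum norm over the sphere is a real supremum, hence meaningful only for functions that are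
  bounded on the sphere.
\<close>

definition sphere_bounded :: "('n::finite ambient \<Rightarrow> 'b::real_normed_vector) \<Rightarrow> bool" where
  "sphere_bounded g \<longleftrightarrow> bounded (g ` sphere 0 1)"

definition sphere_sup_norm :: "('n::finite ambient \<Rightarrow> 'b::real_normed_vector) \<Rightarrow> real" where
  "sphere_sup_norm g = (SUP y\<in>sphere 0 1. norm (g y))"

text \<open>
  The MLS approximations \<open>\<lambda>y. mls L f (Y l) (w l) (Rot y) y\<close> converge uniformly to \<open>f\<close> with the
  rate \<open>\<rho>\<close>. For small \<open>l\<close> they need not exist; existence is part of the claim for all
  sufficiently large \<open>l\<close>.
\<close>

definition mls_converges_with_rate ::
  "nat \<Rightarrow> ('n::finite ambient \<Rightarrow> 'k::real_normed_field) \<Rightarrow> (nat \<Rightarrow> 'n ambient set) \<Rightarrow>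
   (nat \<Rightarrow> 'n ambient \<Rightarrow> 'n ambient \<Rightarrow> real) \<Rightarrow> ('n ambient \<Rightarrow> real ^ ('n option) ^ ('n option)) \<Rightarrow>
   (nat \<Rightarrow> real) \<Rightarrow> bool" where
  "mls_converges_with_rate L f Y w Rot \<rho> \<longleftrightarrow>
     (\<forall>\<^sub>F l in sequentially.
        (\<forall>y\<in>sphere 0 1. mls_defined L f (Y l) (w l) (Rot y) y) \<and>
        sphere_bounded (\<lambda>y. f y - mls L f (Y l) (w l) (Rot y) y)) \<and>
     (\<lambda>l. sphere_sup_norm (\<lambda>y. f y - mls L f (Y l) (w l) (Rot y) y)) \<in> O(\<rho>)"

end

theory Submission
  imports Defs
begin

text \<open>
  Let \<open>t\<close> be the Taylor polynomial of \<open>f\<close> in the tangential coordinates at \<open>y\<close>. Its residual at the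
  nodes of positive weight is \<open>O(\<delta> ^ (L + 1))\<close>, hence so is that of the least squares minimizer \<open>p\<close>,
  because quasi-uniformity bounds the number of these nodes. So \<open>p - t\<close> is \<open>O(\<delta> ^ (L + 1))\<close> at the
  nodes within distance \<open>\<delta> / 2\<close> of \<open>y\<close>. For \<open>\<delta> / h\<close> large they form a norming set for polynomials of
  degree \<open>L\<close> on a ball of radius proportional to \<open>\<delta>\<close>, and therefore
  \<open>p 0 - f y = p 0 - t 0 = O(\<delta> ^ (L + 1))\<close>.
  The norming property also gives unique solvability.

  The Taylor constants have to be uniform in the rotation. Near a fixed chart \<open>G\<close>, all other charts are
  \<open>G\<close> composed with an explicit change of coordinates whose derivatives are polynomial in the
  coordinates and \<open>1 / sqrt (1 - norm x ^ 2)\<close>, so bounds for the composition follow by induction on the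
  order of smoothness; compactness of the sphere reduces everything to finitely many \<open>G\<close>.
\<close>

section \<open>Polynomials and norming sets\<close>

text \<open>The obstacle is uniformity. \<open>rotation_field\<close> imposes no continuity on
  \<open>Rot\<close>, so the charts at different centres are unrelated, and \<open>Ck_on\<close>
  supplies only iterated directional derivatives, for which a chain rule of higher order would be
  clumsy. Smoothness is therefore recorded as approximation: a family has a jet of order m if
  polynomials of degree below m with uniformly bounded coefficients approximate it up to a uniform
  multiple of \<open>norm x ^ m\<close>. This notion survives sums, products and integration along
  rays, so each order costs one chain rule of first order.

  Norming is expressed through coefficients. On a cube of size s the bound for a coefficient of
  degree k loses the factor s ^ k, but the value at the centre is the coefficient of degree 0, where
  nothing is lost; hence the error inherits the rate of the residual. The threshold r is dictated by
  the mesh that norming demands.\<close>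

definition multi_idx :: "nat \<Rightarrow> ('n::finite \<Rightarrow> nat) set" where
  "multi_idx m = {\<alpha>. sum \<alpha> UNIV < m}"

definition multi_pow :: "real ^ 'n::finite \<Rightarrow> ('n \<Rightarrow> nat) \<Rightarrow> 'k::real_normed_field" where
  "multi_pow x \<alpha> = (\<Prod>i\<in>UNIV. of_real (x $ i) ^ \<alpha> i)"

text \<open>The degree is strictly below m: m is then the order of the remainder
  \<open>norm x ^ m\<close>, and m = 0 leaves only the zero polynomial. Degree at most L corresponds
  to \<open>Suc L\<close>.\<close>

definition poly_fun ::
  "nat \<Rightarrow> (('n::finite \<Rightarrow> nat) \<Rightarrow> 'k::real_normed_field) \<Rightarrow> real ^ 'n \<Rightarrow> 'k" where
  "poly_fun m c x = (\<Sum>\<alpha>\<in>multi_idx m. c \<alpha> * multi_pow x \<alpha>)"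

lemma polys_iff: "p \<in> polys L \<longleftrightarrow> (\<exists>c. p = poly_fun (Suc L) c)"
  by (auto simp: polys_def poly_fun_def multi_idx_def multi_pow_def fun_eq_iff less_Suc_eq_le)

lemma finite_multi_idx [simp]: "finite (multi_idx m :: ('n::finite \<Rightarrow> nat) set)"
proof -
  have "multi_idx m \<subseteq> (UNIV :: 'n set) \<rightarrow>\<^sub>E {..m}"
  proof
    fix \<alpha> :: "'n \<Rightarrow> nat" assume "\<alpha> \<in> multi_idx m"
    then have "\<alpha> i \<le> m" for i
      using member_le_sum[of i UNIV \<alpha>] by (simp add: multi_idx_def)
    then show "\<alpha> \<in> UNIV \<rightarrow>\<^sub>E {..m}" by auto
  qed
  then show ?thesis
    by (rule finite_subset) (simp add: finite_PiE)
qed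

lemma norm_multi_pow_le: "norm (multi_pow x \<alpha> :: 'k::real_normed_field) \<le> norm x ^ sum \<alpha> UNIV"
proof -
  have "norm (multi_pow x \<alpha> :: 'k) = (\<Prod>i\<in>UNIV. \<bar>x $ i\<bar> ^ \<alpha> i)"
    by (simp add: multi_pow_def prod_norm [symmetric] norm_power)
  also have "\<dots> \<le> (\<Prod>i\<in>UNIV. norm x ^ \<alpha> i)"
    by (intro prod_mono conjI power_mono) (auto simp: component_le_norm_cart)
  finally show ?thesis by (simp add: power_sum)
qed

lemma multi_pow_add: "multi_pow x (\<lambda>i. \<alpha> i + \<beta> i) = multi_pow x \<alpha> * multi_pow x \<beta>"
  by (simp add: multi_pow_def power_add prod.distrib)

lemma multi_pow_scaleR:
  "multi_pow (t *\<^sub>R x) \<alpha> = (of_real t ^ sum \<alpha> UNIV * multi_pow x \<alpha> :: 'k::real_normed_field)"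
  by (simp add: multi_pow_def power_mult_distrib prod.distrib power_sum)

lemma multi_pow_zero: "multi_pow 0 \<alpha> = (if \<alpha> = (\<lambda>_. 0) then 1 else 0)"
  by (auto simp: multi_pow_def fun_eq_iff power_0_left prod_zero_iff)

lemma poly_fun_zero:
  fixes c :: "('n::finite \<Rightarrow> nat) \<Rightarrow> 'k::real_normed_field"
  shows "poly_fun (Suc L) c 0 = c (\<lambda>_. 0)"
proof -
  have "(\<lambda>_. 0) \<in> (multi_idx (Suc L) :: ('n \<Rightarrow> nat) set)" by (simp add: multi_idx_def)
  then show ?thesis
    by (simp add: poly_fun_def multi_pow_zero if_distrib cong: if_cong)
qed

lemma poly_fun_add: "poly_fun m c x + poly_fun m d x = poly_fun m (\<lambda>\<alpha>. c \<alpha> + d \<alpha>) x"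
  by (simp add: poly_fun_def sum.distrib ring_distribs)

lemma poly_fun_diff: "poly_fun m c x - poly_fun m d x = poly_fun m (\<lambda>\<alpha>. c \<alpha> - d \<alpha>) x"
  by (simp add: poly_fun_def sum_subtractf ring_distribs)

lemma poly_fun_cmult: "a * poly_fun m c x = poly_fun m (\<lambda>\<alpha>. a * c \<alpha>) x"
  by (simp add: poly_fun_def sum_distrib_left mult.assoc)

lemma poly_fun_scaleR:
  "poly_fun m c (t *\<^sub>R x) = poly_fun m (\<lambda>\<alpha>. c \<alpha> * of_real t ^ sum \<alpha> UNIV) x"
  by (simp add: poly_fun_def multi_pow_scaleR mult.assoc)

lemma norm_poly_fun_le:
  fixes x :: "real ^ 'n::finite" and C :: real
  assumes "\<And>\<alpha>. norm (c \<alpha>) \<le> C" "norm x \<le> 1"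
  shows "norm (poly_fun m c x :: 'k::real_normed_field) \<le> card (multi_idx m :: ('n \<Rightarrow> nat) set) * C"
proof -
  have "norm (c \<alpha> * multi_pow x \<alpha>) \<le> C * 1" for \<alpha>
    unfolding norm_mult
    using norm_multi_pow_le[of x \<alpha>, where 'k='k] power_le_one[OF norm_ge_zero assms(2)]
      order_trans[OF norm_ge_zero assms(1)]
    by (intro mult_mono assms) (auto intro: order_trans)
  then have "(\<Sum>\<alpha>\<in>multi_idx m. norm (c \<alpha> * multi_pow x \<alpha>)) \<le> (\<Sum>\<alpha>\<in>(multi_idx m :: ('n \<Rightarrow> nat) set). C)"
    by (intro sum_mono) simp
  then show ?thesis
    unfolding poly_fun_def by (intro order_trans[OF norm_sum]) simp
qed

text \<open>
  Halving the coordinate \<open>i\<close> multiplies the monomial \<open>\<alpha>\<close> by \<open>(1/2) ^ \<alpha> i\<close>, so a suitable multiple of the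
  original polynomial cancels all monomials with \<open>\<alpha> i = k\<close>. Iterating isolates a single coefficient.
\<close>

lemma poly_fun_halving_bound:
  fixes c :: "('n::finite \<Rightarrow> nat) \<Rightarrow> 'k::real_normed_field"
  assumes "finite P" and "\<And>x. (\<And>i. \<bar>x $ i\<bar> \<le> 1 / 2) \<Longrightarrow> norm (poly_fun m c x) \<le> M"
    and "\<And>i. \<bar>x $ i\<bar> \<le> 1 / 2"
  shows "norm (poly_fun m (\<lambda>\<alpha>. c \<alpha> * of_real (\<Prod>(i, k)\<in>P. (1/2) ^ \<alpha> i - (1/2) ^ k)) x) \<le> 2 ^ card P * M"
  using assms(1,3)
proof (induction P arbitrary: x rule: finite_induct)
  case empty
  then show ?case using assms(2) by simp
next
  case (insert p P)
  obtain i k where p: "p = (i, k)" by fastforce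
  let ?c = "\<lambda>\<alpha>. c \<alpha> * of_real (\<Prod>(i, k)\<in>P. (1/2) ^ \<alpha> i - (1/2) ^ k)"
  let ?y = "\<chi> j. if j = i then x $ j / 2 else x $ j"
  have y: "multi_pow ?y \<alpha> = of_real ((1/2) ^ \<alpha> i) * (multi_pow x \<alpha> :: 'k)" for \<alpha>
  proof -
    have "multi_pow ?y \<alpha> = (\<Prod>j\<in>UNIV. (if j = i then of_real ((1/2) ^ \<alpha> i) else 1) * (of_real (x $ j) ^ \<alpha> j :: 'k))"
      unfolding multi_pow_def by (intro prod.cong) (auto simp: power_divide)
    then show ?thesis by (simp add: prod.distrib multi_pow_def)
  qed
  have "poly_fun m (\<lambda>\<alpha>. c \<alpha> * of_real (\<Prod>(i, k)\<in>insert p P. (1/2) ^ \<alpha> i - (1/2) ^ k)) x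
      = poly_fun m ?c ?y - of_real ((1/2) ^ k) * poly_fun m ?c x"
  proof -
    have "of_real (\<Prod>(i, k)\<in>insert p P. (1/2) ^ \<alpha> i - (1/2) ^ k) =
        (of_real ((1/2) ^ \<alpha> i) - of_real ((1/2) ^ k) :: 'k) * of_real (\<Prod>(i, k)\<in>P. (1/2) ^ \<alpha> i - (1/2) ^ k)" for \<alpha>
      using insert.hyps unfolding p by (subst prod.insert) (simp_all only: prod.case of_real_mult of_real_diff not_False_eq_True)
    then show ?thesis
      unfolding poly_fun_def y sum_distrib_left sum_subtractf [symmetric]
      by (intro sum.cong refl) (simp only: left_diff_distrib right_diff_distrib mult_ac)
  qed
  \<comment> \<open>Halving a coordinate does not leave the cube, so the induction hypothesis bounds
    both terms and each pair costs a factor 2.\<close>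
  moreover have "norm (poly_fun m ?c ?y) \<le> 2 ^ card P * M"
  proof (rule insert.IH)
    show "\<bar>?y $ j\<bar> \<le> 1 / 2" for j
    proof -
      have "\<bar>?y $ j\<bar> \<le> \<bar>x $ j\<bar>" by (auto simp: abs_if)
      then show ?thesis using insert.prems[of j] by (rule order_trans)
    qed
  qed
  moreover have "norm (of_real ((1/2) ^ k) * poly_fun m ?c x) \<le> 2 ^ card P * M"
  proof -
    have "norm (of_real ((1/2) ^ k) * poly_fun m ?c x) \<le> 1 * norm (poly_fun m ?c x)"
      unfolding norm_mult by (intro mult_right_mono) (auto simp: norm_power power_le_one)
    then show ?thesis using insert.IH[OF insert.prems] by simp
  qed
  ultimately show ?case
    using insert.hyps norm_triangle_ineq4 [of "poly_fun m ?c ?y" "of_real ((1/2) ^ k) * poly_fun m ?c x"]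
    by simp
qed

text \<open>The pairs (i, k) with k \<le> m and k \<noteq> \<beta> i annihilate every monomial
  except \<beta>, because any other multi-index differs from \<beta> in some entry and entries are
  at most m. Evaluation at a point without zero coordinates then isolates the coefficient. The
  explicit argument avoids compactness and works over every
  \<open>real_normed_field\<close>.\<close>

lemma poly_fun_coeff_bound:
  obtains K :: real where "K > 0"
    "\<And>(c :: ('n::finite \<Rightarrow> nat) \<Rightarrow> 'k::real_normed_field) M \<beta>.
      (\<And>x. (\<And>i. \<bar>x $ i\<bar> \<le> 1 / 2) \<Longrightarrow> norm (poly_fun m c x) \<le> M) \<Longrightarrow>
      \<beta> \<in> multi_idx m \<Longrightarrow> norm (c \<beta>) \<le> K * M"
proof -
  define P :: "('n \<Rightarrow> nat) \<Rightarrow> ('n \<times> nat) set" where "P \<beta> = (SIGMA i:UNIV. {..m} - {\<beta> i})" for \<beta>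
  define A where "A \<beta> = (\<Prod>(i, k)\<in>P \<beta>. (1/2) ^ \<beta> i - (1/2 :: real) ^ k)" for \<beta>
  define e :: "real ^ 'n" where "e = (\<chi> i. 1 / 2)"
  define K where "K \<beta> = 2 ^ card (P \<beta>) / norm (of_real (A \<beta>) * multi_pow e \<beta> :: 'k)" for \<beta>
  have finP: "finite (P \<beta>)" for \<beta> by (simp add: P_def)
  have e0: "multi_pow e \<beta> \<noteq> (0::'k)" for \<beta>
    by (simp add: multi_pow_def e_def)
  have A0: "A \<beta> \<noteq> 0" for \<beta>
    by (auto simp: A_def finP prod_zero_iff P_def power_one_over)
  have K0: "K \<beta> > 0" for \<beta>
    using e0 A0 by (simp add: K_def)
  have main: "norm (c \<beta>) \<le> K \<beta> * M"
    if M: "\<And>x. (\<And>i. \<bar>x $ i\<bar> \<le> 1 / 2) \<Longrightarrow> norm (poly_fun m c x) \<le> M" and \<beta>: "\<beta> \<in> multi_idx m"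
    for c :: "('n \<Rightarrow> nat) \<Rightarrow> 'k" and M \<beta>
  proof -
    have 0: "(\<Prod>(i, k)\<in>P \<beta>. (1/2) ^ \<alpha> i - (1/2 :: real) ^ k) = 0" if "\<alpha> \<in> multi_idx m" and neq: "\<alpha> \<noteq> \<beta>" for \<alpha>
    proof -
      obtain i where i: "\<alpha> i \<noteq> \<beta> i" using neq by (auto simp: fun_eq_iff)
      have "\<alpha> i \<le> m" using that member_le_sum[of i UNIV \<alpha>] by (simp add: multi_idx_def)
      then have "(i, \<alpha> i) \<in> P \<beta>" using i by (simp add: P_def)
      then show ?thesis using finP by (intro prod_zero bexI[of _ "(i, \<alpha> i)"]) auto
    qed
    have "poly_fun m (\<lambda>\<alpha>. c \<alpha> * of_real (\<Prod>(i, k)\<in>P \<beta>. (1/2) ^ \<alpha> i - (1/2) ^ k)) e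
        = (\<Sum>\<alpha>\<in>multi_idx m. if \<alpha> = \<beta> then c \<beta> * of_real (A \<beta>) * multi_pow e \<beta> else 0)"
      unfolding poly_fun_def A_def by (intro sum.cong) (auto simp: 0 simp del: of_real_prod)
    also have "\<dots> = c \<beta> * (of_real (A \<beta>) * multi_pow e \<beta>)"
      using \<beta> by (simp add: mult.assoc)
    finally have "norm (c \<beta> * (of_real (A \<beta>) * multi_pow e \<beta>)) \<le> 2 ^ card (P \<beta>) * M"
      using poly_fun_halving_bound[OF finP M, of e \<beta>] by (simp add: e_def)
    moreover have "norm (of_real (A \<beta>) * multi_pow e \<beta> :: 'k) > 0" using e0 A0 by simp
    ultimately show ?thesis
      by (simp add: K_def norm_mult field_simps)
  qed
  show thesis
  proof (rule that)
    \<comment> \<open>The sum makes the constant independent of \<beta>; the summand 1 keeps it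
      positive when m = 0 and the index set is empty.\<close>
    show "1 + (\<Sum>\<beta>\<in>multi_idx m. K \<beta>) > 0"
      using K0 by (intro add_pos_nonneg sum_nonneg) (auto intro: less_imp_le)
  next
    fix c :: "('n \<Rightarrow> nat) \<Rightarrow> 'k" and M and \<beta> :: "'n \<Rightarrow> nat"
    assume M: "\<And>x. (\<And>i. \<bar>x $ i\<bar> \<le> 1 / 2) \<Longrightarrow> norm (poly_fun m c x) \<le> M" and \<beta>: "\<beta> \<in> multi_idx m"
    have "norm (poly_fun m c 0) \<le> M" by (rule M) simp
    then have "M \<ge> 0" by (rule order_trans[OF norm_ge_zero])
    moreover have "K \<beta> \<le> 1 + (\<Sum>\<beta>\<in>multi_idx m. K \<beta>)"
      using member_le_sum[OF \<beta>, of K] K0 by (simp add: less_imp_le add_increasing)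
    moreover have "norm (c \<beta>) \<le> K \<beta> * M" by (rule main[OF M \<beta>])
    ultimately show "norm (c \<beta>) \<le> (1 + (\<Sum>\<beta>\<in>multi_idx m. K \<beta>)) * M"
      by (meson mult_right_mono order_trans)
  qed
qed

lemma norm_multi_pow_diff_le:
  assumes "\<And>i. \<bar>x $ i\<bar> \<le> 1" "\<And>i. \<bar>y $ i\<bar> \<le> 1"
  shows "norm (multi_pow x \<alpha> - multi_pow y \<alpha> :: 'k::real_normed_field) \<le> real (sum \<alpha> UNIV) * norm (x - y)"
proof -
  have "norm (multi_pow x \<alpha> - multi_pow y \<alpha> :: 'k)
      \<le> (\<Sum>i\<in>UNIV. norm (of_real (x $ i) ^ \<alpha> i - of_real (y $ i) ^ \<alpha> i :: 'k))"
    unfolding multi_pow_def by (intro norm_prod_diff) (auto simp: norm_power power_le_one assms)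
  also have "\<dots> \<le> (\<Sum>i\<in>UNIV. \<alpha> i * norm (x - y))"
  proof (rule sum_mono)
    fix i
    have "norm (of_real (x $ i) ^ \<alpha> i - of_real (y $ i) ^ \<alpha> i :: 'k)
        \<le> \<alpha> i * norm (of_real (x $ i) - of_real (y $ i) :: 'k)"
      by (intro norm_power_diff) (auto simp: assms)
    also have "norm (of_real (x $ i) - of_real (y $ i) :: 'k) \<le> norm (x - y)"
      using component_le_norm_cart[of "x - y" i] by (simp flip: of_real_diff)
    finally show "norm (of_real (x $ i) ^ \<alpha> i - of_real (y $ i) ^ \<alpha> i :: 'k) \<le> \<alpha> i * norm (x - y)"
      by (simp add: mult_left_mono)
  qed
  finally show ?thesis by (simp add: sum_distrib_right)
qed

text \<open>A perturbation argument: with S the largest coefficient in norm, moving from x to a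
  point of Z at distance \<eta> changes the polynomial by at most a multiple of \<eta> * S. In the
  coefficient bound this term is absorbed on the left for small \<eta>.\<close>

lemma norming_set:
  obtains \<eta> K :: real where "0 < \<eta>" "\<eta> \<le> 1 / 2" "K > 0"
    "\<And>(c :: ('n::finite \<Rightarrow> nat) \<Rightarrow> 'k::real_normed_field) M Z \<beta>.
      (\<And>x. (\<And>i. \<bar>x $ i\<bar> \<le> 1 / 2) \<Longrightarrow> \<exists>z\<in>Z. norm (z - x) \<le> \<eta>) \<Longrightarrow>
      (\<And>z. z \<in> Z \<Longrightarrow> (\<And>i. \<bar>z $ i\<bar> \<le> 1) \<Longrightarrow> norm (poly_fun (Suc L) c z) \<le> M) \<Longrightarrow>
      \<beta> \<in> multi_idx (Suc L) \<Longrightarrow> norm (c \<beta>) \<le> K * M"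
proof -
  let ?I = "multi_idx (Suc L) :: ('n \<Rightarrow> nat) set"
  obtain K :: real where K: "K > 0" and coeff:
    "\<And>(c :: ('n \<Rightarrow> nat) \<Rightarrow> 'k) M \<beta>. (\<And>x. (\<And>i. \<bar>x $ i\<bar> \<le> 1 / 2) \<Longrightarrow> norm (poly_fun (Suc L) c x) \<le> M) \<Longrightarrow>
      \<beta> \<in> ?I \<Longrightarrow> norm (c \<beta>) \<le> K * M"
    by (fact poly_fun_coeff_bound)
  \<comment> \<open>D is chosen so that \<eta> \<le> 1 / D makes the absorbed term at most S / 2;
    the summand 1 keeps it positive for L = 0. The minimum with 1 / 2 in \<eta> keeps the nearby
    points inside the unit cube.\<close>
  define D where "D = 2 * K * (1 + real L * card ?I)"
  define \<eta> where "\<eta> = min (1 / 2) (1 / D)"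
  have D: "D > 0" using K by (simp add: D_def add_pos_nonneg)
  have "\<eta> * D \<le> 1 / D * D"
    using D by (intro mult_right_mono) (auto simp: \<eta>_def)
  then have \<eta>D: "\<eta> * D \<le> 1" using D by simp
  have \<eta>0: "\<eta> > 0" using D by (simp add: \<eta>_def)
  have main: "norm (c \<beta>) \<le> 2 * K * M"
    if near: "\<And>x. (\<And>i. \<bar>x $ i\<bar> \<le> 1 / 2) \<Longrightarrow> (\<exists>z\<in>Z. norm (z - x) \<le> \<eta>)"
      and M: "\<And>z. z \<in> Z \<Longrightarrow> (\<And>i. \<bar>z $ i\<bar> \<le> 1) \<Longrightarrow> norm (poly_fun (Suc L) c z) \<le> M" and \<beta>: "\<beta> \<in> ?I"
    for c :: "('n \<Rightarrow> nat) \<Rightarrow> 'k" and M Z \<beta>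
  proof -
    define S where "S = Max ((\<lambda>\<beta>. norm (c \<beta>)) ` ?I)"
    have S: "norm (c \<alpha>) \<le> S" if "\<alpha> \<in> ?I" for \<alpha>
      using that by (simp add: S_def)
    have S0: "S \<ge> 0" using S[OF \<beta>] norm_ge_zero order_trans by blast
    have "norm (poly_fun (Suc L) c x) \<le> M + card ?I * (S * (L * \<eta>))" if x: "\<And>i. \<bar>x $ i\<bar> \<le> 1 / 2" for x
    proof -
      obtain z where z: "z \<in> Z" "norm (z - x) \<le> \<eta>" using near x by blast
      have z1: "\<bar>z $ i\<bar> \<le> 1" for i
        using component_le_norm_cart[of "z - x" i] z(2) x[of i] by (simp add: \<eta>_def abs_if split: if_splits)
      have "norm (c \<alpha> * (multi_pow x \<alpha> - multi_pow z \<alpha>)) \<le> S * (L * \<eta>)" if "\<alpha> \<in> ?I" for \<alpha>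
      proof -
        have "norm (multi_pow x \<alpha> - multi_pow z \<alpha> :: 'k) \<le> real (sum \<alpha> UNIV) * norm (x - z)"
          using z1 order_trans[OF x, of 1] by (intro norm_multi_pow_diff_le) auto
        also have "\<dots> \<le> L * \<eta>"
          using z(2) that by (intro mult_mono) (auto simp: multi_idx_def norm_minus_commute simp flip: of_nat_sum)
        finally show ?thesis
          unfolding norm_mult using S that S0 by (intro mult_mono) auto
      qed
      then have "(\<Sum>\<alpha>\<in>?I. norm (c \<alpha> * (multi_pow x \<alpha> - multi_pow z \<alpha>))) \<le> card ?I * (S * (L * \<eta>))"
        by (rule sum_bounded_above)
      moreover have "poly_fun (Suc L) c x - poly_fun (Suc L) c z
          = (\<Sum>\<alpha>\<in>?I. c \<alpha> * (multi_pow x \<alpha> - multi_pow z \<alpha>))"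
        by (simp add: poly_fun_def sum_subtractf ring_distribs)
      ultimately have "norm (poly_fun (Suc L) c x - poly_fun (Suc L) c z) \<le> card ?I * (S * (L * \<eta>))"
        by (auto intro: order_trans[OF norm_sum])
      moreover have "norm (poly_fun (Suc L) c z) \<le> M" using M z z1 by blast
      ultimately show ?thesis
        using norm_triangle_sub[of "poly_fun (Suc L) c x" "poly_fun (Suc L) c z"] by linarith
    qed
    then have "norm (c \<alpha>) \<le> K * (M + card ?I * (S * (L * \<eta>)))" if "\<alpha> \<in> ?I" for \<alpha>
      using coeff that by blast
    then have "S \<le> K * (M + card ?I * (S * (L * \<eta>)))"
      unfolding S_def using \<beta> by (subst Max_le_iff) auto
    also have "\<dots> \<le> K * M + S / 2 * (\<eta> * D)"
      using K S0 \<eta>0 by (simp add: D_def algebra_simps)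
    also have "\<dots> \<le> K * M + S / 2 * 1"
      using \<eta>D S0 by (intro add_left_mono mult_left_mono) auto
    finally have "S \<le> 2 * K * M" by simp
    then show ?thesis using S[OF \<beta>] by simp
  qed
  show thesis
  proof (rule that)
    show "0 < \<eta>" "\<eta> \<le> 1 / 2" "2 * K > 0" using \<eta>0 K by (simp_all add: \<eta>_def)
  next
    fix c :: "('n \<Rightarrow> nat) \<Rightarrow> 'k" and M Z and \<beta> :: "'n \<Rightarrow> nat"
    assume "\<And>x. (\<And>i. \<bar>x $ i\<bar> \<le> 1 / 2) \<Longrightarrow> \<exists>z\<in>Z. norm (z - x) \<le> \<eta>"
      and "\<And>z. z \<in> Z \<Longrightarrow> (\<And>i. \<bar>z $ i\<bar> \<le> 1) \<Longrightarrow> norm (poly_fun (Suc L) c z) \<le> M"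
      and "\<beta> \<in> ?I"
    then show "norm (c \<beta>) \<le> 2 * K * M" by (rule main)
  qed
qed

lemma norming_set_scaled:
  obtains \<eta> K :: real where "0 < \<eta>" "\<eta> \<le> 1 / 2" "K > 0"
    "\<And>s (c :: ('n::finite \<Rightarrow> nat) \<Rightarrow> 'k::real_normed_field) M Z \<beta>. s > 0 \<Longrightarrow>
      (\<And>x. (\<And>i. \<bar>x $ i\<bar> \<le> s / 2) \<Longrightarrow> \<exists>z\<in>Z. norm (z - x) \<le> \<eta> * s) \<Longrightarrow>
      (\<And>z. z \<in> Z \<Longrightarrow> (\<And>i. \<bar>z $ i\<bar> \<le> s) \<Longrightarrow> norm (poly_fun (Suc L) c z) \<le> M) \<Longrightarrow>
      \<beta> \<in> multi_idx (Suc L) \<Longrightarrow> norm (c \<beta>) * s ^ sum \<beta> UNIV \<le> K * M"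
proof -
  obtain \<eta> K :: real where \<eta>: "0 < \<eta>" "\<eta> \<le> 1 / 2" "K > 0" and norming:
    "\<And>(c :: ('n::finite \<Rightarrow> nat) \<Rightarrow> 'k::real_normed_field) M Z \<beta>.
      (\<And>x. (\<And>i. \<bar>x $ i\<bar> \<le> 1 / 2) \<Longrightarrow> \<exists>z\<in>Z. norm (z - x) \<le> \<eta>) \<Longrightarrow>
      (\<And>z. z \<in> Z \<Longrightarrow> (\<And>i. \<bar>z $ i\<bar> \<le> 1) \<Longrightarrow> norm (poly_fun (Suc L) c z) \<le> M) \<Longrightarrow>
      \<beta> \<in> multi_idx (Suc L) \<Longrightarrow> norm (c \<beta>) \<le> K * M"
    by (fact norming_set)
  have main: "norm (c \<beta>) * s ^ sum \<beta> UNIV \<le> K * M"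
    if s: "s > 0" and near: "\<And>x. (\<And>i. \<bar>x $ i\<bar> \<le> s / 2) \<Longrightarrow> (\<exists>z\<in>Z. norm (z - x) \<le> \<eta> * s)"
      and M: "\<And>z. z \<in> Z \<Longrightarrow> (\<And>i. \<bar>z $ i\<bar> \<le> s) \<Longrightarrow> norm (poly_fun (Suc L) c z) \<le> M"
      and \<beta>: "\<beta> \<in> multi_idx (Suc L)"
    for c :: "('n \<Rightarrow> nat) \<Rightarrow> 'k" and M Z \<beta> s
  proof -
    have "norm (c \<beta> * of_real s ^ sum \<beta> UNIV) \<le> K * M"
    \<comment> \<open>Dilation by s: \<open>poly_fun_scaleR\<close> moves the powers of s from the
      variable into the coefficients.\<close>
    proof (rule norming[of "(\<lambda>z. (1 / s) *\<^sub>R z) ` Z" "\<lambda>\<alpha>. c \<alpha> * of_real s ^ sum \<alpha> UNIV"])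
      fix x :: "real ^ 'n" assume "\<And>i. \<bar>x $ i\<bar> \<le> 1 / 2"
      then obtain z where z: "z \<in> Z" "norm (z - s *\<^sub>R x) \<le> \<eta> * s"
        using near[of "s *\<^sub>R x"] s by (auto simp: abs_mult)
      have "(1 / s) *\<^sub>R z - x = (1 / s) *\<^sub>R (z - s *\<^sub>R x)" using s by (simp add: algebra_simps)
      then have "norm ((1 / s) *\<^sub>R z - x) = norm (z - s *\<^sub>R x) / s" using s by simp
      then have "norm ((1 / s) *\<^sub>R z - x) \<le> \<eta>" using z s by (simp add: pos_divide_le_eq)
      then show "\<exists>z\<in>(\<lambda>z. (1 / s) *\<^sub>R z) ` Z. norm (z - x) \<le> \<eta>" using z by blast
    next
      fix u assume "u \<in> (\<lambda>z. (1 / s) *\<^sub>R z) ` Z" and u: "\<And>i. \<bar>u $ i\<bar> \<le> 1"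
      then obtain z where z: "z \<in> Z" "u = (1 / s) *\<^sub>R z" by blast
      then have "\<bar>z $ i\<bar> \<le> s" for i using u[of i] s by (simp add: abs_mult field_simps)
      moreover have "z = s *\<^sub>R u" using z s by simp
      ultimately show "norm (poly_fun (Suc L) (\<lambda>\<alpha>. c \<alpha> * of_real s ^ sum \<alpha> UNIV) u) \<le> M"
        using M[OF z(1)] by (simp flip: poly_fun_scaleR)
    qed (fact \<beta>)
    then show ?thesis using s by (simp add: norm_mult norm_power)
  qed
  from \<eta> show thesis
  proof (rule that)
    fix c :: "('n \<Rightarrow> nat) \<Rightarrow> 'k" and s M :: real and Z and \<beta> :: "'n \<Rightarrow> nat"
    assume "s > 0"
      and "\<And>x. (\<And>i. \<bar>x $ i\<bar> \<le> s / 2) \<Longrightarrow> \<exists>z\<in>Z. norm (z - x) \<le> \<eta> * s"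
      and "\<And>z. z \<in> Z \<Longrightarrow> (\<And>i. \<bar>z $ i\<bar> \<le> s) \<Longrightarrow> norm (poly_fun (Suc L) c z) \<le> M"
      and "\<beta> \<in> multi_idx (Suc L)"
    then show "norm (c \<beta>) * s ^ sum \<beta> UNIV \<le> K * M" by (rule main)
  qed
qed

section \<open>Uniform jets\<close>

text \<open>The terms of degree m or more are dropped from the product; on the unit ball each of
  their monomials is at most \<open>norm x ^ m\<close>. Coefficients and remainder are both sums
  over sets of index pairs, so one constant E serves for both.\<close>

lemma poly_fun_mult_truncated:
  fixes c d :: "('n::finite \<Rightarrow> nat) \<Rightarrow> 'k::real_normed_field" and C D :: real and m :: nat
  assumes c: "\<And>\<alpha>. norm (c \<alpha>) \<le> C" and d: "\<And>\<alpha>. norm (d \<alpha>) \<le> D"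
  defines "E \<equiv> card (multi_idx m \<times> multi_idx m :: (('n \<Rightarrow> nat) \<times> ('n \<Rightarrow> nat)) set) * (C * D)"
  shows "\<exists>e. (\<forall>\<gamma>. norm (e \<gamma>) \<le> E) \<and>
    (\<forall>x. norm x \<le> 1 \<longrightarrow> norm (poly_fun m c x * poly_fun m d x - poly_fun m e x) \<le> E * norm x ^ m)"
proof -
  let ?I = "multi_idx m :: ('n \<Rightarrow> nat) set"
  let ?add = "\<lambda>(\<alpha>, \<beta>). (\<lambda>i. \<alpha> i + \<beta> i) :: 'n \<Rightarrow> nat"
  let ?f = "\<lambda>(\<alpha>, \<beta>). c \<alpha> * d \<beta>"
  define S where "S = ?I \<times> ?I"
  define e where "e \<gamma> = (\<Sum>p\<in>{p \<in> S. ?add p = \<gamma>}. ?f p)" for \<gamma>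
  have S [simp]: "finite S" by (simp add: S_def)
  have CD: "C \<ge> 0" "D \<ge> 0" using c d norm_ge_zero order_trans by blast+
  have E: "E = card S * (C * D)" by (simp add: E_def S_def)
  have f: "norm (?f p) \<le> C * D" for p
    by (cases p) (auto simp: norm_mult CD intro!: mult_mono c d)
  have sub: "(\<Sum>p\<in>T. norm (?f p)) \<le> E" if "T \<subseteq> S" for T
  proof -
    have "(\<Sum>p\<in>T. norm (?f p)) \<le> card T * (C * D)"
      using f by (rule sum_bounded_above)
    also have "\<dots> \<le> E"
      unfolding E using that CD by (intro mult_right_mono) (auto intro: card_mono)
    finally show ?thesis .
  qed
  have "norm (e \<gamma>) \<le> E" for \<gamma>
    unfolding e_def by (intro order_trans[OF norm_sum] sub) auto
  moreover have "norm (poly_fun m c x * poly_fun m d x - poly_fun m e x) \<le> E * norm x ^ m"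
    if x: "norm x \<le> 1" for x
  proof -
    let ?T = "{p \<in> S. ?add p \<in> ?I}"
    have "poly_fun m e x = (\<Sum>\<gamma>\<in>?I. \<Sum>p\<in>{p \<in> ?T. ?add p = \<gamma>}. ?f p * multi_pow x (?add p))"
      unfolding poly_fun_def e_def sum_distrib_right
      by (intro sum.cong) auto
    also have "\<dots> = (\<Sum>p\<in>?T. ?f p * multi_pow x (?add p))"
      by (intro sum.group) auto
    finally have e: "poly_fun m e x = \<dots>" .
    have "poly_fun m c x * poly_fun m d x = (\<Sum>p\<in>S. ?f p * multi_pow x (?add p))"
      unfolding poly_fun_def sum_product S_def sum.cartesian_product
      by (intro sum.cong) (auto simp: multi_pow_add)
    then have "poly_fun m c x * poly_fun m d x - poly_fun m e x = (\<Sum>p\<in>S - ?T. ?f p * multi_pow x (?add p))"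
      unfolding e by (subst sum_diff) auto
    also have "norm \<dots> \<le> (\<Sum>p\<in>S - ?T. norm (?f p) * norm x ^ m)"
    proof (rule sum_norm_le)
      fix p assume "p \<in> S - ?T"
      then have "m \<le> sum (?add p) UNIV" by (auto simp: multi_idx_def)
      then have "norm (multi_pow x (?add p) :: 'k) \<le> norm x ^ m"
        by (intro order_trans[OF norm_multi_pow_le] power_decreasing x) auto
      then show "norm (?f p * multi_pow x (?add p)) \<le> norm (?f p) * norm x ^ m"
        unfolding norm_mult by (intro mult_left_mono) auto
    qed
    also have "\<dots> \<le> E * norm x ^ m"
      unfolding sum_distrib_right [symmetric] by (intro mult_right_mono sub) auto
    finally show ?thesis .
  qed
  ultimately show ?thesis by blast
qed

text \<open>
  The radius \<open>1 / 8\<close> is small enough for the changes of coordinates considered below to map the ball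
  into the ball of radius \<open>1 / 2\<close>. For \<open>m = 0\<close> the condition says that the family is uniformly bounded.
\<close>

definition uniform_jet :: "nat \<Rightarrow> 'q set \<Rightarrow> ('q \<Rightarrow> real ^ 'n::finite \<Rightarrow> 'k::real_normed_field) \<Rightarrow> bool" where
  "uniform_jet m Q g \<longleftrightarrow> (\<exists>C::real. \<forall>q\<in>Q. \<exists>c. (\<forall>\<alpha>. norm (c \<alpha>) \<le> C) \<and>
     (\<forall>x\<in>cball 0 (1 / 8). norm (g q x - poly_fun m c x) \<le> C * norm x ^ m))"

lemma uniform_jetE:
  assumes "uniform_jet m Q g"
  obtains C c where "C \<ge> 0" "\<And>q \<alpha>. q \<in> Q \<Longrightarrow> norm (c q \<alpha>) \<le> C"
    "\<And>q x. q \<in> Q \<Longrightarrow> norm x \<le> 1 / 8 \<Longrightarrow> norm (g q x - poly_fun m (c q) x) \<le> C * norm x ^ m"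
proof -
  obtain C :: real where "\<forall>q\<in>Q. \<exists>c. (\<forall>\<alpha>. norm (c \<alpha>) \<le> C) \<and>
     (\<forall>x\<in>cball 0 (1 / 8). norm (g q x - poly_fun m c x) \<le> C * norm x ^ m)"
    using assms unfolding uniform_jet_def by blast
  then obtain c where c: "\<forall>q\<in>Q. (\<forall>\<alpha>. norm (c q \<alpha>) \<le> C) \<and>
     (\<forall>x\<in>cball 0 (1 / 8). norm (g q x - poly_fun m (c q) x) \<le> C * norm x ^ m)"
    by (rule bchoice[THEN exE])
  show ?thesis
  proof
    \<comment> \<open>C can be negative when Q is empty, hence the maximum.\<close>
    show "norm (c q \<alpha>) \<le> max C 0" if "q \<in> Q" for q \<alpha>
      using c that by (auto simp: le_max_iff_disj)
    show "norm (g q x - poly_fun m (c q) x) \<le> max C 0 * norm x ^ m" if "q \<in> Q" "norm x \<le> 1 / 8" for q x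
      using c that by (intro order_trans[OF _ mult_right_mono[of C "max C 0"]]) auto
  qed auto
qed

lemma uniform_jetI:
  assumes "\<And>q \<alpha>. q \<in> Q \<Longrightarrow> norm (c q \<alpha>) \<le> C"
    and "\<And>q x. q \<in> Q \<Longrightarrow> norm x \<le> 1 / 8 \<Longrightarrow> norm (g q x - poly_fun m (c q) x) \<le> C * norm x ^ m"
  shows "uniform_jet m Q g"
  unfolding uniform_jet_def
  by (intro exI[of _ C] ballI exI[of _ "c _"]) (use assms in auto)

lemma uniform_jet_bounded:
  assumes "uniform_jet m Q (g :: 'q \<Rightarrow> real ^ 'n::finite \<Rightarrow> 'k::real_normed_field)"
  obtains B where "\<And>q x. q \<in> Q \<Longrightarrow> norm x \<le> 1 / 8 \<Longrightarrow> norm (g q x) \<le> B"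
proof -
  obtain C c where C: "C \<ge> 0" "\<And>q \<alpha>. q \<in> Q \<Longrightarrow> norm (c q \<alpha>) \<le> C"
    "\<And>q x. q \<in> Q \<Longrightarrow> norm x \<le> 1 / 8 \<Longrightarrow> norm (g q x - poly_fun m (c q) x) \<le> C * norm x ^ m"
    using assms by (rule uniform_jetE) blast
  have "norm (g q x) \<le> card (multi_idx m :: ('n \<Rightarrow> nat) set) * C + C" if "q \<in> Q" "norm x \<le> 1 / 8" for q x
  proof -
    have "C * norm x ^ m \<le> C * 1" using C(1) that by (intro mult_left_mono power_le_one) auto
    then show ?thesis
      using C(3)[OF that] norm_poly_fun_le[of "c q" C x m] C(2) that
        norm_triangle_sub[of "g q x" "poly_fun m (c q) x"] by force
  qed
  then show ?thesis using that by blast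
qed

section \<open>Closure properties of uniform jets\<close>

lemma uniform_jet_0:
  assumes "\<And>q x. q \<in> Q \<Longrightarrow> norm x \<le> 1 / 8 \<Longrightarrow> norm (g q x) \<le> B"
  shows "uniform_jet 0 Q g"
  by (rule uniform_jetI[of _ "\<lambda>_ _. 0" "max B 0"])
    (use assms in \<open>auto simp: poly_fun_def multi_idx_def le_max_iff_disj\<close>)

lemma uniform_jet_add:
  assumes "uniform_jet m Q g" "uniform_jet m Q h"
  shows "uniform_jet m Q (\<lambda>q x. g q x + h q x)"
proof -
  obtain C c where C: "C \<ge> 0" "\<And>q \<alpha>. q \<in> Q \<Longrightarrow> norm (c q \<alpha>) \<le> C"
    "\<And>q x. q \<in> Q \<Longrightarrow> norm x \<le> 1 / 8 \<Longrightarrow> norm (g q x - poly_fun m (c q) x) \<le> C * norm x ^ m"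
    using assms(1) by (rule uniform_jetE) blast
  obtain D d where D: "D \<ge> 0" "\<And>q \<alpha>. q \<in> Q \<Longrightarrow> norm (d q \<alpha>) \<le> D"
    "\<And>q x. q \<in> Q \<Longrightarrow> norm x \<le> 1 / 8 \<Longrightarrow> norm (h q x - poly_fun m (d q) x) \<le> D * norm x ^ m"
    using assms(2) by (rule uniform_jetE) blast
  show ?thesis
  proof (rule uniform_jetI)
    show "norm (c q \<alpha> + d q \<alpha>) \<le> C + D" if "q \<in> Q" for q \<alpha>
      using C(2) D(2) that by (intro norm_triangle_le add_mono)
    show "norm (g q x + h q x - poly_fun m (\<lambda>\<alpha>. c q \<alpha> + d q \<alpha>) x) \<le> (C + D) * norm x ^ m"
      if "q \<in> Q" "norm x \<le> 1 / 8" for q x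
      using C(3)[OF that] D(3)[OF that]
        norm_triangle_ineq[of "g q x - poly_fun m (c q) x" "h q x - poly_fun m (d q) x"]
      by (simp add: algebra_simps flip: poly_fun_add)
  qed
qed

lemma uniform_jet_mult:
  assumes "uniform_jet m Q (g :: 'q \<Rightarrow> real ^ 'n::finite \<Rightarrow> 'k::real_normed_field)" "uniform_jet m Q h"
  shows "uniform_jet m Q (\<lambda>q x. g q x * h q x)"
proof -
  obtain C c where C: "C \<ge> 0" "\<And>q \<alpha>. q \<in> Q \<Longrightarrow> norm (c q \<alpha>) \<le> C"
    "\<And>q x. q \<in> Q \<Longrightarrow> norm x \<le> 1 / 8 \<Longrightarrow> norm (g q x - poly_fun m (c q) x) \<le> C * norm x ^ m"
    using assms(1) by (rule uniform_jetE) blast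
  obtain D d where D: "D \<ge> 0" "\<And>q \<alpha>. q \<in> Q \<Longrightarrow> norm (d q \<alpha>) \<le> D"
    "\<And>q x. q \<in> Q \<Longrightarrow> norm x \<le> 1 / 8 \<Longrightarrow> norm (h q x - poly_fun m (d q) x) \<le> D * norm x ^ m"
    using assms(2) by (rule uniform_jetE) blast
  obtain B where B: "\<And>q x. q \<in> Q \<Longrightarrow> norm x \<le> 1 / 8 \<Longrightarrow> norm (h q x) \<le> B"
    using assms(2) by (rule uniform_jet_bounded) blast
  define N where "N = real (card (multi_idx m :: ('n \<Rightarrow> nat) set)) * C"
  define E where "E = card (multi_idx m \<times> multi_idx m :: (('n \<Rightarrow> nat) \<times> ('n \<Rightarrow> nat)) set) * (C * D)"
  have "\<exists>e. (\<forall>\<gamma>. norm (e \<gamma>) \<le> E) \<and>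
    (\<forall>x. norm x \<le> 1 \<longrightarrow> norm (poly_fun m (c q) x * poly_fun m (d q) x - poly_fun m e x) \<le> E * norm x ^ m)"
    if "q \<in> Q" for q
    unfolding E_def using that by (intro poly_fun_mult_truncated C D)
  then obtain e where e: "\<And>q \<gamma>. q \<in> Q \<Longrightarrow> norm (e q \<gamma>) \<le> E"
    "\<And>q x. q \<in> Q \<Longrightarrow> norm x \<le> 1 \<Longrightarrow>
      norm (poly_fun m (c q) x * poly_fun m (d q) x - poly_fun m (e q) x) \<le> E * norm x ^ m"
    by metis
  show ?thesis
  proof (rule uniform_jetI)
    show "norm (e q \<gamma>) \<le> E + (C * \<bar>B\<bar> + N * D)" if "q \<in> Q" for q \<gamma>
      using e(1)[OF that, of \<gamma>] C(1) D(1) by (simp add: N_def add_increasing2)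
    show "norm (g q x * h q x - poly_fun m (e q) x) \<le> (E + (C * \<bar>B\<bar> + N * D)) * norm x ^ m"
      if q: "q \<in> Q" and x: "norm x \<le> 1 / 8" for q x
    proof -
      let ?p = "poly_fun m (c q) x" and ?r = "poly_fun m (d q) x"
      have "norm ((g q x - ?p) * h q x) \<le> (C * norm x ^ m) * \<bar>B\<bar>"
        unfolding norm_mult using C B[OF q x] q x by (intro mult_mono) auto
      moreover have "norm (?p * (h q x - ?r)) \<le> N * (D * norm x ^ m)"
        unfolding norm_mult using D(3)[OF q x] norm_poly_fun_le[of "c q" C x m] C q x
        by (intro mult_mono) (auto simp: N_def)
      moreover have "norm (?p * ?r - poly_fun m (e q) x) \<le> E * norm x ^ m"
        using e q x by simp
      \<comment> \<open>The factors of g h are replaced one after the other by their jets p and r: h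
        is bounded by B and p by N on the ball, and the truncation of p r is covered by
        \<open>poly_fun_mult_truncated\<close>.\<close>
      moreover have "g q x * h q x - poly_fun m (e q) x
          = (?p * ?r - poly_fun m (e q) x) + ((g q x - ?p) * h q x + ?p * (h q x - ?r))"
        by (simp add: algebra_simps)
      ultimately have "norm (g q x * h q x - poly_fun m (e q) x)
          \<le> E * norm x ^ m + ((C * norm x ^ m) * \<bar>B\<bar> + N * (D * norm x ^ m))"
        by (simp only:) (intro norm_triangle_le add_mono)
      then show ?thesis by (simp add: ring_distribs mult_ac)
    qed
  qed
qed

lemma uniform_jet_zero: "uniform_jet m Q (\<lambda>q x. 0)"
  by (rule uniform_jetI[of _ "\<lambda>_ _. 0" 0]) (auto simp: poly_fun_def)

lemma uniform_jet_sum: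
  assumes "\<And>i. i \<in> I \<Longrightarrow> uniform_jet m Q (g i)"
  shows "uniform_jet m Q (\<lambda>q x. \<Sum>i\<in>I. g i q x)"
  using assms
  by (induction I rule: infinite_finite_induct) (simp_all add: uniform_jet_zero uniform_jet_add)

text \<open>Radial integration of a polynomial vector field. On a ray a monomial of degree N scales
  like t ^ N, so as in Euler's identity its coefficient is the sum of the matching coefficients of
  the field divided by N. Only radial derivatives are compared, so the c i need not be the partial
  derivatives of one polynomial.\<close>

lemma has_vector_derivative_poly_fun_ray:
  fixes c :: "'n::finite \<Rightarrow> ('n \<Rightarrow> nat) \<Rightarrow> 'k::real_normed_field" and a :: 'k
  defines "e \<equiv> \<lambda>\<gamma>. if sum \<gamma> UNIV = 0 then a else
     (\<Sum>i\<in>UNIV. if \<gamma> i > 0 then c i (\<gamma>(i := \<gamma> i - 1)) else 0) / of_nat (sum \<gamma> UNIV)"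
  shows "((\<lambda>t. poly_fun (Suc m) e (t *\<^sub>R x)) has_vector_derivative
    (\<Sum>i\<in>UNIV. of_real (x $ i) * poly_fun m (c i) (t *\<^sub>R x))) (at t within S)"
proof -
  let ?I = "multi_idx :: nat \<Rightarrow> ('n \<Rightarrow> nat) set"
  have "((\<lambda>t. poly_fun (Suc m) e (t *\<^sub>R x)) has_vector_derivative
     (\<Sum>\<gamma>\<in>?I (Suc m). (real (sum \<gamma> UNIV) * t ^ (sum \<gamma> UNIV - 1)) *\<^sub>R (e \<gamma> * multi_pow x \<gamma>))) (at t within S)"
  proof -
    have *: "poly_fun (Suc m) e (t *\<^sub>R x) = (\<Sum>\<gamma>\<in>?I (Suc m). (t ^ sum \<gamma> UNIV) *\<^sub>R (e \<gamma> * multi_pow x \<gamma>))" for t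
      unfolding poly_fun_def multi_pow_scaleR by (simp add: scaleR_conv_of_real mult_ac)
    show ?thesis
      unfolding * by (auto intro!: derivative_eq_intros)
  qed
  also have "(\<Sum>\<gamma>\<in>?I (Suc m). (real (sum \<gamma> UNIV) * t ^ (sum \<gamma> UNIV - 1)) *\<^sub>R (e \<gamma> * multi_pow x \<gamma>))
      = (\<Sum>\<gamma>\<in>?I (Suc m). \<Sum>i\<in>UNIV. if \<gamma> i > 0 then
          of_real t ^ (sum \<gamma> UNIV - 1) * (c i (\<gamma>(i := \<gamma> i - 1)) * multi_pow x \<gamma>) else 0)"
  proof (rule sum.cong[OF refl])
    fix \<gamma> :: "'n \<Rightarrow> nat"
    show "(real (sum \<gamma> UNIV) * t ^ (sum \<gamma> UNIV - 1)) *\<^sub>R (e \<gamma> * multi_pow x \<gamma>) =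
      (\<Sum>i\<in>UNIV. if \<gamma> i > 0 then
          of_real t ^ (sum \<gamma> UNIV - 1) * (c i (\<gamma>(i := \<gamma> i - 1)) * multi_pow x \<gamma>) else 0)"
    proof (cases "sum \<gamma> UNIV = 0")
      case True
      then show ?thesis by auto
    next
      case False
      define N where "N = sum \<gamma> UNIV"
      define X where "X = (\<Sum>i\<in>UNIV. if \<gamma> i > 0 then c i (\<gamma>(i := \<gamma> i - 1)) else 0)"
      have "N \<noteq> 0" "e \<gamma> = X / of_nat N" using False by (simp_all only: e_def N_def X_def if_False not_False_eq_True)
      then have "(real N * t ^ (N - 1)) *\<^sub>R (e \<gamma> * multi_pow x \<gamma>) = of_real t ^ (N - 1) * (X * multi_pow x \<gamma>)"
        by (simp add: scaleR_conv_of_real)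
      also have "\<dots> = (\<Sum>i\<in>UNIV. if \<gamma> i > 0 then
          of_real t ^ (N - 1) * (c i (\<gamma>(i := \<gamma> i - 1)) * multi_pow x \<gamma>) else 0)"
        unfolding X_def sum_distrib_left sum_distrib_right by (intro sum.cong refl) simp
      finally show ?thesis unfolding N_def .
    qed
  qed
  also have "\<dots> = (\<Sum>i\<in>UNIV. \<Sum>\<gamma>\<in>{\<gamma> \<in> ?I (Suc m). \<gamma> i > 0}.
          of_real t ^ (sum \<gamma> UNIV - 1) * (c i (\<gamma>(i := \<gamma> i - 1)) * multi_pow x \<gamma>))"
    by (subst sum.swap) (simp only: sum.inter_filter finite_multi_idx)
  also have "\<dots> = (\<Sum>i\<in>UNIV. of_real (x $ i) * poly_fun m (c i) (t *\<^sub>R x))"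
  proof (rule sum.cong[OF refl])
    fix i
    let ?up = "\<lambda>\<alpha> :: 'n \<Rightarrow> nat. \<alpha>(i := Suc (\<alpha> i))"
    have up: "?up \<alpha> = (\<lambda>j. \<alpha> j + (if j = i then 1 else 0))" for \<alpha> by auto
    have sum_up: "sum (?up \<alpha>) UNIV = Suc (sum \<alpha> UNIV)" for \<alpha>
      unfolding up by (simp add: sum.distrib)
    have pow_up: "multi_pow x (?up \<alpha>) = of_real (x $ i) * (multi_pow x \<alpha> :: 'k)" for \<alpha>
    proof -
      have "multi_pow x (\<lambda>j. if j = i then 1 else 0) = (\<Prod>j\<in>UNIV. if j = i then of_real (x $ i) else 1 :: 'k)"
        unfolding multi_pow_def by (intro prod.cong) auto
      then show ?thesis unfolding up multi_pow_add by simp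
    qed
    have down: "?up (\<gamma>(i := \<gamma> i - 1)) = \<gamma>" if "\<gamma> i > 0" for \<gamma>
      using that by auto
    \<comment> \<open>Multiplication by the i-th variable matches the monomials of degree below m
      with those of degree below m + 1 that contain this variable.\<close>
    have "bij_betw ?up (?I m) {\<gamma> \<in> ?I (Suc m). \<gamma> i > 0}"
    proof (rule bij_betwI[where g = "\<lambda>\<gamma>. \<gamma>(i := \<gamma> i - 1)"])
      show "(\<lambda>\<gamma>. \<gamma>(i := \<gamma> i - 1)) \<in> {\<gamma> \<in> ?I (Suc m). \<gamma> i > 0} \<rightarrow> ?I m"
      proof
        fix \<gamma> assume \<gamma>: "\<gamma> \<in> {\<gamma> \<in> ?I (Suc m). \<gamma> i > 0}"
        then have "sum \<gamma> UNIV = Suc (sum (\<gamma>(i := \<gamma> i - 1)) UNIV)"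
          using sum_up[of "\<gamma>(i := \<gamma> i - 1)"] down[of \<gamma>] by simp
        then show "\<gamma>(i := \<gamma> i - 1) \<in> ?I m" using \<gamma> by (simp add: multi_idx_def)
      qed
    next
      show "?up \<in> ?I m \<rightarrow> {\<gamma> \<in> ?I (Suc m). \<gamma> i > 0}"
        by (intro Pi_I) (simp only: multi_idx_def mem_Collect_eq sum_up Suc_less_eq fun_upd_same zero_less_Suc)
    qed (auto simp: fun_eq_iff)
    then have "(\<Sum>\<gamma>\<in>{\<gamma> \<in> ?I (Suc m). \<gamma> i > 0}.
          of_real t ^ (sum \<gamma> UNIV - 1) * (c i (\<gamma>(i := \<gamma> i - 1)) * multi_pow x \<gamma>))
        = (\<Sum>\<alpha>\<in>?I m. of_real t ^ (sum (?up \<alpha>) UNIV - 1) * (c i ((?up \<alpha>)(i := ?up \<alpha> i - 1)) * multi_pow x (?up \<alpha>)))"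
      by (rule sum.reindex_bij_betw[symmetric])
    also have "\<dots> = of_real (x $ i) * poly_fun m (c i) (t *\<^sub>R x)"
      unfolding poly_fun_def sum_up pow_up
      by (auto simp: sum_distrib_left multi_pow_scaleR mult_ac intro!: sum.cong)
    finally show "(\<Sum>\<gamma>\<in>{\<gamma> \<in> ?I (Suc m). \<gamma> i > 0}.
          of_real t ^ (sum \<gamma> UNIV - 1) * (c i (\<gamma>(i := \<gamma> i - 1)) * multi_pow x \<gamma>))
        = of_real (x $ i) * poly_fun m (c i) (t *\<^sub>R x)" .
  qed
  finally show ?thesis .
qed

text \<open>
  Taylor's theorem in integrated form: jets of order \<open>m\<close> of the gradient yield jets of order \<open>m + 1\<close>
  by the mean value inequality along rays.
\<close>

lemma uniform_jet_Suc:
  fixes g :: "'q \<Rightarrow> real ^ 'n::finite \<Rightarrow> 'k::real_normed_field"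
  assumes deriv: "\<And>q x t. q \<in> Q \<Longrightarrow> norm x \<le> 1 / 8 \<Longrightarrow> t \<in> {0..1} \<Longrightarrow>
      ((\<lambda>t. g q (t *\<^sub>R x)) has_vector_derivative (\<Sum>i\<in>UNIV. of_real (x $ i) * g' i q (t *\<^sub>R x)))
        (at t within {0..1})"
    and jet: "\<And>i. uniform_jet m Q (g' i)"
    and B: "\<And>q. q \<in> Q \<Longrightarrow> norm (g q 0) \<le> B"
  shows "uniform_jet (Suc m) Q g"
proof -
  have "\<forall>i. \<exists>C c. C \<ge> 0 \<and> (\<forall>q\<in>Q. \<forall>\<alpha>. norm (c q \<alpha>) \<le> C) \<and>
    (\<forall>q\<in>Q. \<forall>x. norm x \<le> 1 / 8 \<longrightarrow> norm (g' i q x - poly_fun m (c q) x) \<le> C * norm x ^ m)"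
    using jet by (metis uniform_jetE)
  then obtain C c where C: "\<And>i. C i \<ge> 0" "\<And>i q \<alpha>. q \<in> Q \<Longrightarrow> norm (c i q \<alpha>) \<le> C i"
    "\<And>i q x. q \<in> Q \<Longrightarrow> norm x \<le> 1 / 8 \<Longrightarrow> norm (g' i q x - poly_fun m (c i q) x) \<le> C i * norm x ^ m"
    by metis
  define e where "e q = (\<lambda>\<gamma>. if sum \<gamma> UNIV = 0 then g q 0 else
     (\<Sum>i\<in>UNIV. if \<gamma> i > 0 then c i q (\<gamma>(i := \<gamma> i - 1)) else 0) / of_nat (sum \<gamma> UNIV))" for q
  define S where "S = (\<Sum>i\<in>UNIV. C i)"
  have S: "S \<ge> 0" using C(1) by (simp add: S_def sum_nonneg)
  show ?thesis
  proof (rule uniform_jetI)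
    show "norm (e q \<gamma>) \<le> \<bar>B\<bar> + S" if "q \<in> Q" for q \<gamma>
    proof (cases "sum \<gamma> UNIV = 0")
      case True
      then have "e q \<gamma> = g q 0" by (simp add: e_def)
      then show ?thesis using B[OF that] S by simp
    next
      case False
      then have "real (sum \<gamma> UNIV) \<ge> 1" by linarith
      then have "norm (e q \<gamma>) \<le> norm (\<Sum>i\<in>UNIV. if \<gamma> i > 0 then c i q (\<gamma>(i := \<gamma> i - 1)) else 0) / 1"
        unfolding e_def using False
        by (simp only: norm_divide norm_of_nat if_False) (intro divide_left_mono, simp_all del: of_nat_sum sum_eq_0_iff)
      also have "\<dots> \<le> S"
        unfolding S_def div_by_1 using C(1) C(2)[OF that] by (intro sum_norm_le) auto
      finally show ?thesis by simp
    qed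
    show "norm (g q x - poly_fun (Suc m) (e q) x) \<le> (\<bar>B\<bar> + S) * norm x ^ Suc m"
      if q: "q \<in> Q" and x: "norm x \<le> 1 / 8" for q x
    proof -
      let ?D = "\<lambda>t. g q (t *\<^sub>R x) - poly_fun (Suc m) (e q) (t *\<^sub>R x)"
      let ?D' = "\<lambda>t. \<Sum>i\<in>UNIV. of_real (x $ i) * (g' i q (t *\<^sub>R x) - poly_fun m (c i q) (t *\<^sub>R x))"
      have D: "(?D has_vector_derivative ?D' t) (at t within {0..1})" if "t \<in> {0..1}" for t
        using has_vector_derivative_diff[OF deriv[OF q x that]
          has_vector_derivative_poly_fun_ray[of m "g q 0" "\<lambda>i. c i q" x t "{0..1}"]]
        by (simp add: e_def ring_distribs sum_subtractf)
      \<comment> \<open>The factors x $ i supply the additional power of \<open>norm x\<close>, and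
        t \<le> 1 keeps the ray inside the ball where the jets are valid.\<close>
      have D': "norm (?D' t) \<le> S * norm x ^ Suc m" if t: "t \<in> {0..1}" for t
      proof -
        have tx: "norm (t *\<^sub>R x) \<le> norm x" using t mult_right_mono[of t 1 "norm x"] by simp
        have "norm (of_real (x $ i) * (g' i q (t *\<^sub>R x) - poly_fun m (c i q) (t *\<^sub>R x))) \<le> norm x * (C i * norm x ^ m)" for i
        proof -
          have "norm (g' i q (t *\<^sub>R x) - poly_fun m (c i q) (t *\<^sub>R x)) \<le> C i * norm (t *\<^sub>R x) ^ m"
            using C(3) q tx x by (meson order_trans)
          also have "\<dots> \<le> C i * norm x ^ m"
            using tx C(1) by (intro mult_left_mono power_mono) auto
          finally show ?thesis
            unfolding norm_mult using component_le_norm_cart[of x i] by (intro mult_mono) auto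
        qed
        then have "norm (?D' t) \<le> (\<Sum>i\<in>UNIV. norm x * (C i * norm x ^ m))"
          by (rule sum_norm_le)
        then show ?thesis by (simp add: S_def sum_distrib_left sum_distrib_right mult_ac)
      qed
      have "norm (?D 1 - ?D 0) \<le> (S * norm x ^ Suc m) * norm (1 - 0 :: real)"
      proof (rule differentiable_bound)
        show "convex {0..1::real}" by simp
        show "(?D has_derivative (\<lambda>h. h *\<^sub>R ?D' t)) (at t within {0..1})" if "t \<in> {0..1}" for t
          using D[OF that] by (simp add: has_vector_derivative_def)
        show "onorm (\<lambda>h. h *\<^sub>R ?D' t) \<le> S * norm x ^ Suc m" if "t \<in> {0..1}" for t
          by (rule onorm_le) (use D'[OF that] in \<open>auto simp: mult.commute mult_left_mono\<close>)
      qed auto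
      moreover have "?D 0 = 0" by (simp add: poly_fun_zero e_def)
      ultimately show ?thesis
        by (simp add: ring_distribs add_increasing)
    qed
  qed
qed

section \<open>Jets of constants, coordinates and the inverse square root\<close>

lemma uniform_jet_const:
  assumes "\<And>q. q \<in> Q \<Longrightarrow> norm (a q) \<le> B"
  shows "uniform_jet m Q (\<lambda>q x. a q)"
proof (cases m)
  case 0
  then show ?thesis using uniform_jet_0[OF assms] by simp
next
  case (Suc k)
  show ?thesis unfolding Suc
    by (rule uniform_jet_Suc[where g' = "\<lambda>_ _ _. 0"]) (use assms in \<open>auto simp: uniform_jet_zero\<close>)
qed

lemma uniform_jet_component:
  "uniform_jet m Q (\<lambda>q (x :: real ^ 'n::finite). of_real (x $ i) :: 'k::real_normed_field)"
proof (cases m)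
  case 0
  have "norm (of_real (x $ i) :: 'k) \<le> 1 / 8" if "norm x \<le> 1 / 8" for x :: "real ^ 'n"
    using component_le_norm_cart[of x i] that by simp
  then show ?thesis unfolding 0 by (rule uniform_jet_0)
next
  case (Suc k)
  show ?thesis unfolding Suc
  proof (rule uniform_jet_Suc[where g' = "\<lambda>j _ _. if j = i then 1 else 0" and B = 0])
    show "((\<lambda>t. of_real ((t *\<^sub>R x) $ i) :: 'k) has_vector_derivative
        (\<Sum>j\<in>UNIV. of_real (x $ j) * (if j = i then 1 else 0))) (at t within {0..1})" for x :: "real ^ 'n" and t
      by (auto intro!: derivative_eq_intros simp: if_distrib cong: if_cong)
  qed (auto intro: uniform_jet_const)
qed

text \<open>The function s(x) = 1 / sqrt (1 - |x|^2) satisfies the closed differential equation d s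
  / d x_i = x_i * s ^ 3. A jet of order m of s thus yields one of its gradient by products, and
  integration along rays raises the order to m + 1.\<close>

lemma uniform_jet_inverse_sqrt:
  "uniform_jet m Q (\<lambda>q (x :: real ^ 'n::finite). of_real (1 / sqrt (1 - (norm x)\<^sup>2)) :: 'k::real_normed_field)"
proof -
  let ?s = "\<lambda>x :: real ^ 'n. 1 / sqrt (1 - (norm x)\<^sup>2)"
  have pos: "1 - (norm x)\<^sup>2 \<ge> 1 / 4" if "norm x \<le> 1 / 8" for x :: "real ^ 'n"
    using power_mono[OF that norm_ge_zero, of 2] by (simp add: power2_eq_square)
  have bound: "norm (of_real (?s x) :: 'k) \<le> 2" if "norm x \<le> 1 / 8" for x
  proof -
    have "sqrt (1 - (norm x)\<^sup>2) \<ge> 1 / 2"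
      by (rule real_le_rsqrt) (use pos[OF that] in \<open>simp add: power2_eq_square\<close>)
    then have "\<bar>sqrt (1 - (norm x)\<^sup>2)\<bar> \<ge> 1 / 2" by linarith
    then have "1 / \<bar>sqrt (1 - (norm x)\<^sup>2)\<bar> \<le> 1 / (1 / 2)" by (intro divide_left_mono) auto
    then show ?thesis by (simp add: norm_divide)
  qed
  show ?thesis
  proof (induction m)
    case 0
    show ?case using bound by (intro uniform_jet_0)
  next
    case (Suc m)
    show ?case
    proof (rule uniform_jet_Suc[where g' = "\<lambda>i _ x. of_real (x $ i) * (of_real (?s x) * (of_real (?s x) * of_real (?s x)))"
          and B = 2])
      show "uniform_jet m Q (\<lambda>_ x. of_real (x $ i) * (of_real (?s x) * (of_real (?s x) * of_real (?s x))) :: 'k)" for i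
        by (intro uniform_jet_mult Suc uniform_jet_component)
      show "norm (of_real (?s 0) :: 'k) \<le> 2" by simp
      show "((\<lambda>t. of_real (?s (t *\<^sub>R x)) :: 'k) has_vector_derivative
          (\<Sum>i\<in>UNIV. of_real (x $ i) * (of_real ((t *\<^sub>R x) $ i) * (of_real (?s (t *\<^sub>R x)) * (of_real (?s (t *\<^sub>R x)) * of_real (?s (t *\<^sub>R x)))))))
          (at t within {0..1})" if x: "norm x \<le> 1 / 8" and t: "t \<in> {0..1}" for x t
      proof -
        have "norm (t *\<^sub>R x) \<le> 1 / 8" using x t mult_mono[of t 1 "norm x" "1 / 8"] by simp
        from pos[OF this] have p: "1 - (t * norm x)\<^sup>2 > 0" using t by simp
        have "((\<lambda>t. 1 / sqrt (1 - (t * norm x)\<^sup>2)) has_real_derivative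
            t * (norm x)\<^sup>2 * (1 / sqrt (1 - (t * norm x)\<^sup>2)) ^ 3) (at t within {0..1})"
          using p
          by (auto intro!: derivative_eq_intros simp: power3_eq_cube power2_eq_square field_simps)
        then have "((\<lambda>t. of_real (1 / sqrt (1 - (t * norm x)\<^sup>2)) :: 'k) has_vector_derivative
            of_real (t * (norm x)\<^sup>2 * (1 / sqrt (1 - (t * norm x)\<^sup>2)) ^ 3)) (at t within {0..1})"
          by (intro has_vector_derivative_of_real) (simp add: has_real_derivative_iff_has_vector_derivative)
        moreover have norm_eq: "(norm (t *\<^sub>R x))\<^sup>2 = (t * norm x)\<^sup>2" for t
          by (simp add: power_mult_distrib)
        moreover have "(\<Sum>i\<in>UNIV. of_real (x $ i) * (of_real ((t *\<^sub>R x) $ i) * (of_real z * (of_real z * of_real z)))) =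
            (of_real (t * (norm x)\<^sup>2 * z ^ 3) :: 'k)" for z
        proof -
          have "(norm x)\<^sup>2 = (\<Sum>i\<in>UNIV. x $ i * x $ i)"
            by (simp add: norm_vec_def L2_set_def sum_nonneg power2_eq_square)
          then have "t * (norm x)\<^sup>2 * z ^ 3 = (\<Sum>i\<in>UNIV. x $ i * ((t *\<^sub>R x) $ i * (z * (z * z))))"
            by (simp add: sum_distrib_left sum_distrib_right power3_eq_cube mult_ac)
          then show ?thesis by simp
        qed
        ultimately show ?thesis by (simp only:)
      qed
    qed
  qed
qed

section \<open>Uniform Taylor expansion on the sphere\<close>

lemma sum_UNIV_option: "(\<Sum>i\<in>UNIV. f i) = f None + (\<Sum>j\<in>UNIV. f (Some (j :: 'n::finite)))"
  by (simp add: UNIV_option_conv sum.reindex)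

lemma norm_ambient: "(norm y)\<^sup>2 = (y $ None)\<^sup>2 + (norm (sphere_proj_inv y))\<^sup>2"
  for y :: "'n::finite ambient"
  by (simp add: norm_vec_def L2_set_def sum_nonneg sum_UNIV_option sphere_proj_inv_def add_nonneg_nonneg)

lemma sphere_proj_inv_sphere_proj [simp]: "sphere_proj_inv (sphere_proj x) = x"
  by (simp add: sphere_proj_inv_def sphere_proj_def vec_eq_iff)

lemma norm_sphere_proj:
  assumes "norm x \<le> 1"
  shows "norm (sphere_proj x) = 1"
proof -
  have "(norm x)\<^sup>2 \<le> 1" using assms by (simp add: power_le_one)
  then have "(norm (sphere_proj x))\<^sup>2 = 1"
    by (simp add: norm_ambient) (simp add: sphere_proj_def)
  then show ?thesis by (simp add: power2_eq_1_iff) (use norm_ge_zero[of "sphere_proj x"] in linarith)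
qed

lemma sphere_proj_sphere_proj_inv:
  assumes "norm y = 1" "y $ None \<ge> 0"
  shows "sphere_proj (sphere_proj_inv y) = y"
proof -
  have "1 - (norm (sphere_proj_inv y))\<^sup>2 = (y $ None)\<^sup>2"
    using norm_ambient[of y] assms(1) by simp
  then show ?thesis
    using assms(2) by (simp add: vec_eq_iff sphere_proj_def sphere_proj_inv_def split: option.split)
qed

lemma sphere_proj_inv_diff: "sphere_proj_inv (y - z) = sphere_proj_inv y - sphere_proj_inv z"
  by (simp add: sphere_proj_inv_def vec_eq_iff)

lemma norm_sphere_proj_inv_le: "norm (sphere_proj_inv y) \<le> norm y"
  by (rule power2_le_imp_le) (simp_all add: norm_ambient)

lemma sphere_proj_0: "sphere_proj 0 = north"
  by (simp add: sphere_proj_def north_def axis_def vec_eq_iff split: option.split)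

lemma sphere_proj_inv_north [simp]: "sphere_proj_inv north = 0"
  by (simp add: sphere_proj_inv_def north_def axis_def vec_eq_iff)

lemma norm_sphere_proj_inv_le_dist_north: "norm (sphere_proj_inv y) \<le> norm (y - north)"
  using norm_sphere_proj_inv_le[of "y - north"] by (simp add: sphere_proj_inv_diff)

lemma norm_sphere_proj_minus_north_le:
  assumes "norm x \<le> 1"
  shows "norm (sphere_proj x - north) \<le> 2 * norm x"
proof -
  define r where "r = (norm x)\<^sup>2"
  have r: "0 \<le> r" "r \<le> 1" using assms by (simp_all add: r_def power_le_one)
  \<comment> \<open>The height of the point differs from 1 by at most r, so the last coordinate
    contributes at most r ^ 2 \<le> r to the squared distance.\<close>
  have "1 - r \<le> sqrt (1 - r)"
    using r by (intro real_le_rsqrt) (simp add: power2_eq_square mult_left_le)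
  then have "(1 - sqrt (1 - r))\<^sup>2 \<le> r\<^sup>2"
    using r by (intro power_mono) auto
  also have "\<dots> \<le> r" using r by (simp add: power2_eq_square mult_left_le)
  finally have "(sqrt (1 - r) - 1)\<^sup>2 \<le> r" by (simp add: power2_commute)
  then have "(norm (sphere_proj x - north))\<^sup>2 \<le> 2 * r"
    by (simp add: norm_ambient sphere_proj_inv_diff) (simp add: r_def sphere_proj_def north_def axis_def)
  also have "\<dots> \<le> (2 * norm x)\<^sup>2" by (simp add: r_def power_mult_distrib)
  finally show ?thesis by (rule power2_le_imp_le) simp
qed

section \<open>Changes of tangential coordinates\<close>

lemma norm_orthogonal_matrix_mult:
  assumes "orthogonal_matrix (A :: real ^ 'm ^ 'm)"
  shows "norm (A *v x) = norm x"
  using assms orthogonal_transformation_norm[of "(*v) A"]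
  by (simp add: orthogonal_transformation_matrix)

lemma norm_orthogonal_matrix_component_le:
  assumes "orthogonal_matrix (A :: real ^ 'm ^ 'm)"
  shows "\<bar>A $ i $ j\<bar> \<le> 1"
proof -
  have "\<bar>(A *v axis j 1) $ i\<bar> \<le> norm (A *v axis j 1)" by (rule component_le_norm_cart)
  then show ?thesis
    using assms by (simp only: norm_orthogonal_matrix_mult) (simp add: matrix_vector_mult_basis column_def)
qed

text \<open>Transition map between two charts of \<open>Ck_sphere\<close>; below, A is the rotation
  of one chart followed by the inverse of that of the other.\<close>

definition chart_change :: "real ^ ('n option) ^ ('n option) \<Rightarrow> real ^ 'n \<Rightarrow> real ^ 'n::finite" where
  "chart_change A x = sphere_proj_inv (A *v sphere_proj x)"

text \<open>The only nonlinear ingredient is the scalar square root, multiplied by a fixed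
  vector.\<close>

lemma chart_change_eq:
  "chart_change A x = (\<chi> j. \<Sum>i\<in>UNIV. A $ Some j $ Some i * x $ i)
    + sqrt (1 - (norm x)\<^sup>2) *\<^sub>R (\<chi> j. A $ Some j $ None)"
  by (simp add: chart_change_def vec_eq_iff sphere_proj_inv_def matrix_vector_mult_def
      sum_UNIV_option sphere_proj_def mult.commute)

text \<open>The parameter set for uniformity: orthogonality bounds all entries by 1, and the bound
  on the tilt keeps the image of a small ball inside a compact part of the chart.\<close>

definition near_north :: "(real ^ ('n option) ^ ('n::finite option)) set" where
  "near_north = {A. orthogonal_matrix A \<and> norm (A *v north - north) \<le> 1 / 4}"

text \<open>For \<open>norm x\<close> at most 1 / 8 the point \<open>sphere_proj x\<close> is within
  1 / 4 of \<open>north\<close>; the tilt adds another 1 / 4. Being within 1 / 2 of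
  \<open>north\<close>, the image lies in the open upper half sphere, where the projection can be
  inverted.\<close>

lemma
  fixes A :: "real ^ ('n option) ^ ('n::finite option)"
  assumes "A \<in> near_north" "norm x \<le> 1 / 8"
  shows norm_chart_change_le: "norm (chart_change A x) \<le> 1 / 2"
    and sphere_proj_chart_change: "sphere_proj (chart_change A x) = A *v sphere_proj x"
proof -
  have A: "orthogonal_matrix A" "norm (A *v north - north) \<le> 1 / 4"
    using assms(1) by (auto simp: near_north_def)
  have "norm (A *v (sphere_proj x - north)) \<le> 1 / 4"
    using norm_sphere_proj_minus_north_le[of x] assms(2) by (simp add: norm_orthogonal_matrix_mult[OF A(1)])
  then have *: "norm (A *v sphere_proj x - north) \<le> 1 / 2"
    using norm_triangle_ineq[of "A *v (sphere_proj x - north)" "A *v north - north"] A(2)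
    by (simp add: matrix_vector_mult_diff_distrib)
  then show "norm (chart_change A x) \<le> 1 / 2"
    unfolding chart_change_def using norm_sphere_proj_inv_le_dist_north order_trans by blast
  have "\<bar>(A *v sphere_proj x - north) $ None\<bar> \<le> 1 / 2"
    using * component_le_norm_cart order_trans by blast
  moreover have "(north :: 'n ambient) $ None = 1" by (simp add: north_def axis_def)
  ultimately have "(A *v sphere_proj x) $ None \<ge> 0"
    unfolding vector_minus_component by linarith
  then show "sphere_proj (chart_change A x) = A *v sphere_proj x"
    unfolding chart_change_def
    using assms(2) by (intro sphere_proj_sphere_proj_inv) (simp_all add: norm_orthogonal_matrix_mult[OF A(1)] norm_sphere_proj)
qed

text \<open>The derivative is arranged as a sum of x $ i times partial derivatives at t x, the form
  that \<open>uniform_jet_Suc\<close> expects; \<open>norm x\<close> squared is expanded into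
  coordinates for this purpose.\<close>

lemma has_vector_derivative_chart_change_ray:
  fixes x :: "real ^ 'n::finite"
  assumes x: "norm x \<le> 1 / 8" and t: "t \<in> {0..1}"
  shows "((\<lambda>t. chart_change A (t *\<^sub>R x)) has_vector_derivative
    (\<chi> j. \<Sum>i\<in>UNIV. x $ i * (A $ Some j $ Some i
       - A $ Some j $ None * ((t *\<^sub>R x) $ i * (1 / sqrt (1 - (norm (t *\<^sub>R x))\<^sup>2)))))) (at t within {0..1})"
proof -
  define a where "a = (\<chi> j. \<Sum>i\<in>UNIV. A $ Some j $ Some i * x $ i)"
  define b where "b = (\<chi> j. A $ Some j $ None)"
  have "norm (t *\<^sub>R x) \<le> 1 / 8" using x t mult_mono[of t 1 "norm x" "1 / 8"] by simp
  from power_mono[OF this norm_ge_zero, of 2] have p: "1 - (t * norm x)\<^sup>2 > 0"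
    by (simp add: power2_eq_square power_mult_distrib)
  have "(\<Sum>i\<in>UNIV. A $ Some j $ Some i * (t *\<^sub>R x) $ i) = t * a $ j" for j t
    by (simp add: a_def sum_distrib_left mult_ac)
  then have *: "chart_change A (t *\<^sub>R x) = t *\<^sub>R a + sqrt (1 - (t * norm x)\<^sup>2) *\<^sub>R b" for t
    by (simp add: chart_change_eq b_def vec_eq_iff power_mult_distrib)
  have "((\<lambda>t. sqrt (1 - (t * norm x)\<^sup>2)) has_real_derivative
      - (t * (norm x)\<^sup>2 * (1 / sqrt (1 - (t * norm x)\<^sup>2)))) (at t within {0..1})"
    using p by (auto intro!: derivative_eq_intros simp: power2_eq_square field_simps)
  from has_vector_derivative_add[OF has_vector_derivative_scaleR[OF DERIV_ident has_vector_derivative_const[of a]]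
      has_vector_derivative_scaleR[OF this has_vector_derivative_const[of b]]]
  have "((\<lambda>t. t *\<^sub>R a + sqrt (1 - (t * norm x)\<^sup>2) *\<^sub>R b) has_vector_derivative
      a + (- (t * (norm x)\<^sup>2 * (1 / sqrt (1 - (t * norm x)\<^sup>2)))) *\<^sub>R b) (at t within {0..1})"
    by simp
  also have "a + (- (t * (norm x)\<^sup>2 * (1 / sqrt (1 - (t * norm x)\<^sup>2)))) *\<^sub>R b =
    (\<chi> j. \<Sum>i\<in>UNIV. x $ i * (A $ Some j $ Some i
       - A $ Some j $ None * ((t *\<^sub>R x) $ i * (1 / sqrt (1 - (norm (t *\<^sub>R x))\<^sup>2)))))"
  proof -
    have n: "(norm x)\<^sup>2 = (\<Sum>i\<in>UNIV. x $ i * x $ i)"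
      by (simp add: norm_vec_def L2_set_def sum_nonneg power2_eq_square)
    have "(norm (t *\<^sub>R x))\<^sup>2 = (t * norm x)\<^sup>2" by (simp add: power_mult_distrib)
    then show ?thesis
      by (simp add: vec_eq_iff a_def b_def n right_diff_distrib sum_subtractf sum_distrib_left sum_distrib_right
          sum_divide_distrib mult_ac)
  qed
  finally show ?thesis unfolding * .
qed

text \<open>By the chain rule a partial derivative of the composition is a sum of products of a
  partial derivative of G after \<open>chart_change\<close> and an expression in x, the inverse
  square root and entries of A. The former is covered by the induction hypothesis, hence the
  generalization over G; the latter has jets of every order.\<close>

lemma uniform_jet_Ck_chart_change:
  fixes G :: "real ^ 'n::finite \<Rightarrow> 'k::real_normed_field"
  assumes "Ck_on m (ball 0 1) G"
  shows "uniform_jet m near_north (\<lambda>A x. G (chart_change A x))"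
  using assms
proof (induction m arbitrary: G)
  case 0
  \<comment> \<open>All images of \<open>chart_change\<close> lie in this compact ball inside the
    domain, so one bound holds for all A.\<close>
  then have "continuous_on (cball 0 (1 / 2)) G"
    by (auto intro: continuous_on_subset)
  then have "compact (G ` cball 0 (1 / 2))"
    by (intro compact_continuous_image) auto
  then obtain B where B: "\<And>x. x \<in> cball 0 (1 / 2) \<Longrightarrow> norm (G x) \<le> B"
    by (metis bounded_iff compact_imp_bounded imageI)
  show ?case
    using norm_chart_change_le by (intro uniform_jet_0[of _ _ B] B) auto
next
  case (Suc m)
  define G' where "G' j x = frechet_derivative G (at x) (axis j 1)" for j x
  have G: "(G has_derivative frechet_derivative G (at x)) (at x)" if "norm x < 1" for x
    using Suc.prems that by (simp add: frechet_derivative_works)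
  have jet: "uniform_jet m near_north (\<lambda>A x. G' j (chart_change A x))" for j
    unfolding G'_def using Suc.prems by (intro Suc.IH) simp
  let ?s = "\<lambda>x :: real ^ 'n. 1 / sqrt (1 - (norm x)\<^sup>2)"
  define D where "D i A x = (\<Sum>j\<in>UNIV. (of_real (A $ Some j $ Some i) +
      of_real (- A $ Some j $ None) * (of_real (x $ i) * of_real (?s x))) * G' j (chart_change A x))"
    for i and A :: "real ^ ('n option) ^ ('n option)" and x
  have entry: "norm (of_real (A $ i $ j) :: 'k) \<le> 1" "norm (of_real (- A $ i $ j) :: 'k) \<le> 1"
    if "A \<in> near_north" for A :: "real ^ ('n option) ^ ('n option)" and i j
    using that norm_orthogonal_matrix_component_le[of A i j] by (auto simp: near_north_def)
  have "continuous_on (cball 0 (1 / 2)) G"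
    by (intro continuous_at_imp_continuous_on ballI has_derivative_continuous[OF G]) simp
  then have "compact (G ` cball 0 (1 / 2))"
    by (intro compact_continuous_image) auto
  then obtain B where B: "\<And>x. x \<in> cball 0 (1 / 2) \<Longrightarrow> norm (G x) \<le> B"
    by (metis bounded_iff compact_imp_bounded imageI)
  show ?case
  proof (rule uniform_jet_Suc)
    show "uniform_jet m near_north (D i)" for i
      unfolding D_def
      by (intro uniform_jet_sum uniform_jet_mult uniform_jet_add jet uniform_jet_component
          uniform_jet_inverse_sqrt uniform_jet_const[of _ _ 1]) (use entry in auto)
    have c0: "norm (chart_change A 0) \<le> 1 / 2" if "A \<in> near_north" for A :: "real ^ ('n option) ^ ('n option)"
      using that by (intro norm_chart_change_le) auto
    show "norm (G (chart_change A 0)) \<le> B" if "A \<in> near_north" for A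
      using c0[OF that] by (intro B) auto
  next
    fix A :: "real ^ ('n option) ^ ('n option)" and x :: "real ^ 'n" and t :: real
    assume A: "A \<in> near_north" and x: "norm x \<le> 1 / 8" and t: "t \<in> {0..1}"
    define v where "v = (\<chi> j. \<Sum>i\<in>UNIV. x $ i * (A $ Some j $ Some i
       - A $ Some j $ None * ((t *\<^sub>R x) $ i * ?s (t *\<^sub>R x))))"
    let ?y = "chart_change A (t *\<^sub>R x)"
    have "norm (t *\<^sub>R x) \<le> 1 / 8" using x t mult_mono[of t 1 "norm x" "1 / 8"] by simp
    then have y: "norm ?y < 1" using norm_chart_change_le[OF A, of "t *\<^sub>R x"] by simp
    have "(G \<circ> (\<lambda>t. chart_change A (t *\<^sub>R x)) has_vector_derivative frechet_derivative G (at ?y) v) (at t within {0..1})"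
      unfolding v_def
      by (rule vector_derivative_diff_chain_within[OF has_vector_derivative_chart_change_ray[OF x t]])
        (rule has_derivative_at_withinI[OF G[OF y]])
    also have "frechet_derivative G (at ?y) v = (\<Sum>j\<in>UNIV. v $ j *\<^sub>R G' j ?y)"
    proof -
      have lin: "linear (frechet_derivative G (at ?y))" using G[OF y] has_derivative_linear by blast
      have "v = (\<Sum>j\<in>UNIV. v $ j *\<^sub>R axis j 1)"
        using basis_expansion[of v] by (simp add: scalar_mult_eq_scaleR)
      then have "frechet_derivative G (at ?y) v = frechet_derivative G (at ?y) (\<Sum>j\<in>UNIV. v $ j *\<^sub>R axis j 1)"
        by (rule arg_cong)
      also have "\<dots> = (\<Sum>j\<in>UNIV. v $ j *\<^sub>R G' j ?y)"
        by (simp add: linear_sum[OF lin] linear_scale[OF lin] G'_def)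
      finally show ?thesis .
    qed
    also have "\<dots> = (\<Sum>i\<in>UNIV. of_real (x $ i) * D i A (t *\<^sub>R x))"
      unfolding D_def v_def scaleR_conv_of_real vec_lambda_beta of_real_sum sum_distrib_right sum_distrib_left
      by (subst sum.swap) (simp add: algebra_simps)
    finally show "((\<lambda>t. G (chart_change A (t *\<^sub>R x))) has_vector_derivative
        (\<Sum>i\<in>UNIV. of_real (x $ i) * D i A (t *\<^sub>R x))) (at t within {0..1})"
      by (simp add: o_def)
  qed
qed

section \<open>Taylor polynomials for arbitrary rotations\<close>

lemma rotation_matrix_transpose: "rotation_matrix A \<Longrightarrow> rotation_matrix (transpose A)"
  by (simp add: rotation_matrix_def)

lemma rotation_matrix_transpose_mult [simp]:
  assumes "rotation_matrix (A :: real ^ 'm ^ 'm)"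
  shows "transpose A *v (A *v x) = x" "A *v (transpose A *v x) = x"
  using assms unfolding rotation_matrix_def orthogonal_matrix_def matrix_vector_mul_assoc by simp_all

lemma norm_rotation_matrix_mult: "rotation_matrix A \<Longrightarrow> norm (A *v x) = norm (x :: real ^ 'm)"
  by (simp add: rotation_matrix_def norm_orthogonal_matrix_mult)

text \<open>The chart of B at y0 is held fixed. Any other chart, given by A at y, differs from it by
  Q = \<open>B ** transpose A\<close>, which sends \<open>north\<close> to B y; since B y0 = north,
  the tilt of Q is exactly the distance of y to y0. So C depends on y0 but not on y or A.\<close>

lemma taylor_near:
  fixes f :: "'n::finite ambient \<Rightarrow> 'k::real_normed_field"
  assumes f: "Ck_sphere m f" and B: "rotation_matrix B" "B *v y0 = north"
  obtains C :: real where "\<And>y A. norm (y - y0) \<le> 1 / 4 \<Longrightarrow> rotation_matrix A \<Longrightarrow> A *v y = north \<Longrightarrow>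
    \<exists>c. \<forall>x. norm x \<le> 1 / 8 \<longrightarrow> norm (f (transpose A *v sphere_proj x) - poly_fun m c x) \<le> C * norm x ^ m"
proof -
  define G where "G x = f (transpose B *v sphere_proj x)" for x
  have "Ck_on m (ball 0 1) G"
    using f rotation_matrix_transpose[OF B(1)] unfolding Ck_sphere_def G_def by blast
  then have "uniform_jet m near_north (\<lambda>A x. G (chart_change A x))"
    by (rule uniform_jet_Ck_chart_change)
  then obtain C c where C: "\<And>Q x. Q \<in> near_north \<Longrightarrow> norm x \<le> 1 / 8 \<Longrightarrow>
      norm (G (chart_change Q x) - poly_fun m (c Q) x) \<le> C * norm x ^ m"
    by (rule uniform_jetE) blast
  show thesis
  proof (rule that)
    fix y :: "'n ambient" and A :: "real ^ ('n option) ^ ('n option)"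
    assume y: "norm (y - y0) \<le> 1 / 4" and A: "rotation_matrix A" "A *v y = north"
    define Q where "Q = B ** transpose A"
    have Q: "Q *v z = B *v (transpose A *v z)" for z
      unfolding Q_def by (rule matrix_vector_mul_assoc [symmetric])
    have "transpose A *v north = y" using A by (metis rotation_matrix_transpose_mult(1))
    then have "Q *v north - north = B *v (y - y0)"
      using B(2) by (simp add: Q matrix_vector_mult_diff_distrib)
    moreover have "orthogonal_matrix Q"
      using A(1) B(1) by (simp add: Q_def rotation_matrix_def orthogonal_matrix_mul)
    ultimately have Qn: "Q \<in> near_north"
      using y B(1) by (simp add: near_north_def norm_rotation_matrix_mult)
    have "G (chart_change Q x) = f (transpose A *v sphere_proj x)" if "norm x \<le> 1 / 8" for x
      unfolding G_def sphere_proj_chart_change[OF Qn that] Q rotation_matrix_transpose_mult(1)[OF B(1)] ..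
    then show "\<exists>c. \<forall>x. norm x \<le> 1 / 8 \<longrightarrow> norm (f (transpose A *v sphere_proj x) - poly_fun m c x) \<le> C * norm x ^ m"
      using C[OF Qn] by (intro exI[of _ "c Q"]) auto
  qed
qed

lemma taylor_uniform:
  fixes f :: "'n::finite ambient \<Rightarrow> 'k::real_normed_field"
  assumes f: "Ck_sphere m f" and Rot: "rotation_field Rot"
  obtains C :: real where "C \<ge> 0" "\<And>y. y \<in> sphere 0 1 \<Longrightarrow>
    \<exists>c. \<forall>x. norm x \<le> 1 / 8 \<longrightarrow> norm (f (transpose (Rot y) *v sphere_proj x) - poly_fun m c x) \<le> C * norm x ^ m"
proof -
  let ?P = "\<lambda>C y. \<exists>c. \<forall>x. norm x \<le> 1 / 8 \<longrightarrow>
    norm (f (transpose (Rot y) *v sphere_proj x) - poly_fun m c x) \<le> C * norm x ^ m"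
  have mono: "?P D y" if "?P C y" "C \<le> D" for C D y
  proof -
    from that(1) obtain c where c: "\<And>x. norm x \<le> 1 / 8 \<Longrightarrow>
      norm (f (transpose (Rot y) *v sphere_proj x) - poly_fun m c x) \<le> C * norm x ^ m" by blast
    show ?thesis
      using that(2) by (intro exI[of _ c] allI impI order_trans[OF c] mult_right_mono) auto
  qed
  have "seq_compact (sphere 0 1 :: 'n ambient set)" by (simp add: compact_imp_seq_compact)
  then obtain K :: "'n ambient set" where K: "finite K" "K \<subseteq> sphere 0 1" "sphere 0 1 \<subseteq> (\<Union>y\<in>K. ball y (1 / 4))"
    using seq_compact_imp_totally_bounded by (metis zero_less_divide_1_iff zero_less_numeral)
  have "\<exists>C. \<forall>y\<in>sphere 0 1. norm (y - y0) \<le> 1 / 4 \<longrightarrow> ?P C y" if "y0 \<in> K" for y0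
  proof -
    have "rotation_matrix (Rot y0)" "Rot y0 *v y0 = north"
      using that K(2) Rot by (auto simp: rotation_field_def)
    from taylor_near[OF f this] obtain C where C: "\<And>y A. norm (y - y0) \<le> 1 / 4 \<Longrightarrow> rotation_matrix A \<Longrightarrow> A *v y = north \<Longrightarrow>
      \<exists>c. \<forall>x. norm x \<le> 1 / 8 \<longrightarrow> norm (f (transpose A *v sphere_proj x) - poly_fun m c x) \<le> C * norm x ^ m"
      by blast
    show ?thesis
      using Rot by (intro exI[of _ C] ballI impI C) (auto simp: rotation_field_def)
  qed
  then obtain C where C: "\<And>y0 y. y0 \<in> K \<Longrightarrow> y \<in> sphere 0 1 \<Longrightarrow> norm (y - y0) \<le> 1 / 4 \<Longrightarrow> ?P (C y0) y"
    by metis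
  show thesis
  proof (rule that)
    \<comment> \<open>Summing absolute values over the finite cover K gives a common upper bound
      that is nonnegative as well.\<close>
    show "0 \<le> (\<Sum>y\<in>K. \<bar>C y\<bar>)" by (simp add: sum_nonneg)
    fix y :: "'n ambient" assume y: "y \<in> sphere 0 1"
    then obtain y0 where y0: "y0 \<in> K" "norm (y - y0) \<le> 1 / 4"
      using K(3) by (force simp: dist_norm norm_minus_commute)
    have "C y0 \<le> (\<Sum>y\<in>K. \<bar>C y\<bar>)"
      using member_le_sum[OF y0(1), of "\<lambda>y. \<bar>C y\<bar>"] K(1) by force
    with C[OF y0(1) y y0(2)] show "?P (\<Sum>y\<in>K. \<bar>C y\<bar>) y" by (rule mono)
  qed
qed

section \<open>Nodes on the sphere and least squares\<close>

text \<open>With u = x / 2 and u * cos u \<le> sin u, the double angle formulas give sin x = 2 * sin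
  u * cos u \<ge> u * (1 + cos x) \<ge> u.\<close>

lemma half_le_sin:
  assumes "0 \<le> x" "x \<le> pi / 2"
  shows "x / 2 \<le> sin x"
proof -
  define u where "u = x / 2"
  have u: "0 \<le> u" "u \<le> pi / 4" using assms by (simp_all add: u_def)
  have "sin 0 - 0 * cos 0 \<le> sin u - u * cos (u :: real)"
  proof (rule DERIV_nonneg_imp_nondecreasing[OF u(1)])
    fix v :: real assume v: "0 \<le> v" "v \<le> u"
    have "((\<lambda>v. sin v - v * cos v) has_real_derivative v * sin v) (at v)"
      by (auto intro!: derivative_eq_intros)
    moreover have "v * sin v \<ge> 0" using v u by (intro mult_nonneg_nonneg sin_ge_zero) auto
    ultimately show "\<exists>d. ((\<lambda>v. sin v - v * cos v) has_real_derivative d) (at v) \<and> 0 \<le> d" by blast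
  qed
  then have 1: "u * cos u \<le> sin u" by simp
  have "u * 1 \<le> u * (1 + cos x)"
    using assms u by (intro mult_left_mono) (simp_all add: cos_ge_zero)
  also have "\<dots> = 2 * (u * cos u) * cos u"
    using cos_double_cos[of u] by (simp add: u_def power2_eq_square)
  also have "\<dots> \<le> 2 * sin u * cos u"
    using 1 u by (intro mult_right_mono) (auto intro: cos_ge_zero)
  also have "\<dots> = sin x" using sin_double[of u] by (simp add: u_def)
  finally show ?thesis by (simp add: u_def)
qed

text \<open>The chord of an arc of length \<theta> is 2 * sin (\<theta> / 2). Hence geodesic and
  Euclidean distance agree up to a factor 2, and all later estimates can be made in the ambient
  space.\<close>

lemma
  assumes "norm y = 1" "norm z = 1"
  shows norm_diff_le_gdist: "norm (y - z) \<le> gdist y z"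
    and gdist_le_norm_diff: "gdist y z \<le> 2 * norm (y - z)"
    and gdist_le_pi: "gdist y z \<le> pi"
proof -
  define \<theta> where "\<theta> = gdist y z"
  have "\<bar>y \<bullet> z\<bar> \<le> 1" using Cauchy_Schwarz_ineq2[of y z] assms by simp
  then have \<theta>: "0 \<le> \<theta>" "\<theta> \<le> pi" "cos \<theta> = y \<bullet> z"
    by (auto simp: \<theta>_def gdist_def arccos_lbound arccos_ubound)
  have "(norm (y - z))\<^sup>2 = 2 - 2 * (y \<bullet> z)"
    using assms by (simp add: power2_norm_eq_inner inner_diff inner_commute norm_eq_1)
  also have "\<dots> = (2 * sin (\<theta> / 2))\<^sup>2"
    using cos_double_sin[of "\<theta> / 2"] \<theta>(3) by (simp add: power_mult_distrib)
  finally have chord: "norm (y - z) = 2 * sin (\<theta> / 2)"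
    by (rule power2_eq_imp_eq) (use \<theta> in \<open>simp_all add: sin_ge_zero\<close>)
  then show "norm (y - z) \<le> gdist y z"
    using sin_x_le_x[of "\<theta> / 2"] \<theta> by (simp add: \<theta>_def)
  show "gdist y z \<le> 2 * norm (y - z)"
    using half_le_sin[of "\<theta> / 2"] \<theta> chord by (simp add: \<theta>_def)
  show "gdist y z \<le> pi" using \<theta>(2) by (simp add: \<theta>_def)
qed

section \<open>Fill distance, separation and packing of nodes\<close>

lemma gdist_commute: "gdist y z = gdist z y"
  by (simp add: gdist_def inner_commute)

lemma node_near:
  assumes Y: "node_set Y" and y: "norm y = 1"
  obtains z where "z \<in> Y" "gdist z y \<le> fill_dist Y"
proof -
  let ?m = "\<lambda>y. Min ((\<lambda>z. gdist z y) ` Y)"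
  have fin: "finite Y" "Y \<noteq> {}" and sph: "\<And>z. z \<in> Y \<Longrightarrow> norm z = 1"
    using Y by (auto simp: node_set_def)
  \<comment> \<open>The real supremum in \<open>fill_dist\<close> bounds its members only once
    boundedness above is known.\<close>
  have "bdd_above (?m ` sphere 0 1)"
  proof (rule bdd_aboveI2)
    fix x :: "'a ambient" assume x: "x \<in> sphere 0 1"
    obtain z where "z \<in> Y" using fin by blast
    then have "?m x \<le> gdist z x" using fin by simp
    also have "\<dots> \<le> pi" using sph[OF \<open>z \<in> Y\<close>] x by (intro gdist_le_pi) auto
    finally show "?m x \<le> pi" .
  qed
  then have "?m y \<le> fill_dist Y"
    unfolding fill_dist_def using y by (intro cSUP_upper) auto
  moreover have "?m y \<in> (\<lambda>z. gdist z y) ` Y" using fin by (intro Min_in) auto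
  ultimately show thesis using that by auto
qed

lemma infinite_sphere: "infinite (sphere 0 1 :: 'n::finite ambient set)"
proof
  assume fin: "finite (sphere 0 1 :: 'n ambient set)"
  have "norm (sphere_proj x) = 1" if "x \<in> ball 0 1" for x :: "real ^ 'n"
    by (rule norm_sphere_proj) (use that in simp)
  then have "sphere_proj ` ball 0 1 \<subseteq> (sphere 0 1 :: 'n ambient set)"
    by (intro image_subsetI) simp
  moreover have "inj_on sphere_proj (ball 0 1 :: (real ^ 'n) set)"
    by (rule inj_on_inverseI[of _ sphere_proj_inv]) simp
  ultimately have "finite (ball 0 1 :: (real ^ 'n) set)"
    using fin by (metis finite_imageD finite_subset)
  then show False
    using uncountable_ball[of 1 "0 :: real ^ 'n"] by (simp add: uncountable_infinite)
qed

text \<open>Otherwise each point of the infinite sphere would be a node. Positivity is needed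
  because R times the fill distance is a denominator in the weight.\<close>

lemma fill_dist_pos:
  assumes "node_set Y"
  shows "fill_dist Y > 0"
proof (rule ccontr)
  assume neg: "\<not> fill_dist Y > 0"
  have "sphere 0 1 \<subseteq> Y"
  proof
    fix y :: "'a ambient" assume "y \<in> sphere 0 1"
    then have y: "norm y = 1" by simp
    then obtain z where z: "z \<in> Y" "gdist z y \<le> fill_dist Y" using assms node_near by blast
    have "norm z = 1" using z(1) assms by (auto simp: node_set_def)
    then have "norm (z - y) \<le> 0"
      using norm_diff_le_gdist[of z y] y z(2) neg by linarith
    then show "y \<in> Y" using z(1) by simp
  qed
  then show False using assms infinite_sphere finite_subset by (auto simp: node_set_def)
qed

lemma
  assumes "node_set Y"
  shows sep_dist_le: "z \<in> Y \<Longrightarrow> z' \<in> Y \<Longrightarrow> z \<noteq> z' \<Longrightarrow> 2 * sep_dist Y \<le> gdist z z'"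
    and sep_dist_pos: "sep_dist Y > 0"
proof -
  let ?D = "{gdist y z |y z. y \<in> Y \<and> z \<in> Y \<and> y \<noteq> z}"
  have fin: "finite Y" and sph: "\<And>z. z \<in> Y \<Longrightarrow> norm z = 1"
    using assms by (auto simp: node_set_def)
  have "?D \<subseteq> (\<lambda>(y, z). gdist y z) ` (Y \<times> Y)" by auto
  then have D: "finite ?D" using fin by (meson finite_SigmaI finite_imageI finite_subset)
  show "2 * sep_dist Y \<le> gdist z z'" if "z \<in> Y" "z' \<in> Y" "z \<noteq> z'"
    unfolding sep_dist_def using that Min_le[OF D, of "gdist z z'"] by auto
  have "2 \<le> card Y" using assms by (simp add: node_set_def)
  then obtain y z where "y \<in> Y" "z \<in> Y" "y \<noteq> z"
    using fin by (metis card_le_Suc0_iff_eq not_less_eq_eq numeral_2_eq_2)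
  then have "gdist y z \<in> ?D" by auto
  then have "Min ?D \<in> ?D" using D by (intro Min_in) auto
  then obtain y z where yz: "y \<in> Y" "z \<in> Y" "y \<noteq> z" "Min ?D = gdist y z"
    unfolding mem_Collect_eq by (elim exE conjE)
  have "0 < norm (y - z)" using yz by simp
  also have "\<dots> \<le> gdist y z" using yz sph by (intro norm_diff_le_gdist) auto
  finally show "sep_dist Y > 0" unfolding sep_dist_def using yz by simp
qed

text \<open>After rescaling to the unit ball, a finite cover by balls of radius \<kappa> / 2 is
  fixed. Two points sharing a covering ball would be closer than \<kappa>, so there are at most as
  many points as balls.\<close>

lemma packing_bound:
  assumes "\<kappa> > 0"
  obtains N :: nat where "\<And>(y :: 'a::euclidean_space) \<delta> S. \<delta> > 0 \<Longrightarrow> finite S \<Longrightarrow> (\<And>z. z \<in> S \<Longrightarrow> norm (z - y) \<le> \<delta>) \<Longrightarrow>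
    (\<And>z z'. z \<in> S \<Longrightarrow> z' \<in> S \<Longrightarrow> z \<noteq> z' \<Longrightarrow> \<kappa> * \<delta> \<le> norm (z - z')) \<Longrightarrow> card S \<le> N"
proof -
  have "seq_compact (cball 0 1 :: 'a set)" by (simp add: compact_imp_seq_compact)
  moreover have "\<kappa> / 2 > 0" using assms by simp
  ultimately obtain K :: "'a set" where K: "finite K" "cball 0 1 \<subseteq> (\<Union>x\<in>K. ball x (\<kappa> / 2))"
    using seq_compact_imp_totally_bounded by metis
  show thesis
  proof (rule that)
    fix y :: 'a and \<delta> S
    assume \<delta>: "\<delta> > 0" and S: "finite S" "\<And>z. z \<in> S \<Longrightarrow> norm (z - y) \<le> \<delta>"
      and sep: "\<And>z z'. z \<in> S \<Longrightarrow> z' \<in> S \<Longrightarrow> z \<noteq> z' \<Longrightarrow> \<kappa> * \<delta> \<le> norm (z - z')"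
    define u where "u z = (1 / \<delta>) *\<^sub>R (z - y)" for z
    have "\<exists>k\<in>K. norm (k - u z) < \<kappa> / 2" if "z \<in> S" for z
    proof -
      have "u z \<in> cball 0 1" using S(2)[OF that] \<delta> by (simp add: u_def)
      then have "u z \<in> (\<Union>x\<in>K. ball x (\<kappa> / 2))" using K(2) by blast
      then show ?thesis by (auto simp: dist_norm)
    qed
    then obtain k where k: "\<And>z. z \<in> S \<Longrightarrow> k z \<in> K" "\<And>z. z \<in> S \<Longrightarrow> norm (k z - u z) < \<kappa> / 2"
      by metis
    have "inj_on k S"
    proof (rule inj_onI, rule ccontr)
      fix z z' assume z: "z \<in> S" "z' \<in> S" "k z = k z'" "z \<noteq> z'"
      have "norm (u z' - u z) < \<kappa>"
        using k(2)[OF z(1)] k(2)[OF z(2)] z(3) norm_triangle_ineq4[of "k z - u z" "k z' - u z'"] by simp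
      moreover have "u z' - u z = (1 / \<delta>) *\<^sub>R (z' - z)" by (simp add: u_def scaleR_diff_right)
      ultimately have "norm (z' - z) < \<kappa> * \<delta>" using \<delta> by (simp add: pos_divide_less_eq)
      then show False using sep[OF z(2,1)] z(4) by force
    qed
    then show "card S \<le> card K"
      using k(1) K(1) by (intro card_inj_on_le) auto
  qed
qed

section \<open>Weighted least squares\<close>

lemma compact_PiE_UNIV:
  fixes S :: "'i \<Rightarrow> 'a::topological_space set"
  assumes "\<And>i. compact (S i)"
  shows "compact (PiE UNIV S)"
proof -
  have "compactin (product_topology (\<lambda>_. euclidean) UNIV) (PiE UNIV S)"
    using assms by (subst compactin_PiE) simp
  then show ?thesis by (simp add: euclidean_product_topology)
qed

text \<open>The parallelogram law as quantitative strict convexity; it yields uniqueness of the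
  minimizer.\<close>

lemma norm_midpoint_sq:
  "(norm (F - (1 / 2) *\<^sub>R (a + b)))\<^sup>2 = (norm (F - a))\<^sup>2 / 2 + (norm (F - b))\<^sup>2 / 2 - (norm (a - b))\<^sup>2 / 4"
  for F a b :: "'a::real_inner"
  by (simp add: power2_norm_eq_inner inner_diff inner_add inner_commute field_simps)

text \<open>The hypothesis \<open>unisolvent\<close> serves twice. For existence it confines the
  coefficients of all competitors no worse than 0 to a compact set; for uniqueness, with M = 0, it
  forces two minimizers that agree at the nodes to coincide.\<close>

lemma least_squares_unique_solution:
  fixes X :: "'z \<Rightarrow> real ^ 'n::finite" and F :: "'z \<Rightarrow> 'k::{real_normed_field, euclidean_space}" and K :: "('n \<Rightarrow> nat) \<Rightarrow> real"
  assumes Z: "finite Z" and \<omega>: "\<And>z. z \<in> Z \<Longrightarrow> \<omega> z > 0"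
    and unisolvent: "\<And>c M \<beta>. (\<And>z. z \<in> Z \<Longrightarrow> norm (poly_fun (Suc L) c (X z) :: 'k) \<le> M) \<Longrightarrow>
        \<beta> \<in> multi_idx (Suc L) \<Longrightarrow> norm (c \<beta>) \<le> K \<beta> * M"
  shows "\<exists>!p. is_arg_min (\<lambda>p. \<Sum>z\<in>Z. \<omega> z * (norm (F z - p (X z)))\<^sup>2) (\<lambda>p. p \<in> polys L) p"
proof -
  let ?I = "multi_idx (Suc L) :: ('n \<Rightarrow> nat) set"
  let ?P = "poly_fun (Suc L) :: (('n \<Rightarrow> nat) \<Rightarrow> 'k) \<Rightarrow> real ^ 'n \<Rightarrow> 'k"
  define E where "E p = (\<Sum>z\<in>Z. \<omega> z * (norm (F z - p (X z)))\<^sup>2)" for p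
  have polys: "p \<in> polys L \<longleftrightarrow> (\<exists>c. p = ?P c)" for p by (rule polys_iff)
  have "\<exists>c. \<forall>d. E (?P c) \<le> E (?P d)"
  proof -
    define E0 where "E0 = E (?P (\<lambda>_. 0))"
    define M where "M = (\<Sum>z\<in>Z. norm (F z) + sqrt (E0 / \<omega> z))"
    have E0: "E0 \<ge> 0"
      unfolding E0_def E_def using \<omega> by (intro sum_nonneg mult_nonneg_nonneg) (auto intro: less_imp_le)
    have bound: "norm (c \<beta>) \<le> K \<beta> * M" if "E (?P c) \<le> E0" "\<beta> \<in> ?I" for c \<beta>
    proof (rule unisolvent[OF _ that(2)])
      fix z assume z: "z \<in> Z"
      have "\<omega> z * (norm (F z - ?P c (X z)))\<^sup>2 \<le> E (?P c)"
        unfolding E_def using Z \<omega> z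
        by (intro member_le_sum[of z Z "\<lambda>z. \<omega> z * (norm (F z - ?P c (X z)))\<^sup>2"] mult_nonneg_nonneg)
          (auto intro: less_imp_le)
      then have "(norm (F z - ?P c (X z)))\<^sup>2 \<le> E0 / \<omega> z"
        using that(1) \<omega>[OF z] by (simp add: pos_le_divide_eq mult.commute)
      then have "norm (F z - ?P c (X z)) \<le> sqrt (E0 / \<omega> z)" by (rule real_le_rsqrt)
      then have "norm (?P c (X z)) \<le> norm (F z) + sqrt (E0 / \<omega> z)"
        using norm_triangle_sub[of "?P c (X z)" "F z"] by (simp add: norm_minus_commute)
      also have "\<dots> \<le> M"
        unfolding M_def using Z z E0 \<omega>
        by (intro member_le_sum[of z Z "\<lambda>z. norm (F z) + sqrt (E0 / \<omega> z)"]) (auto intro!: add_nonneg_nonneg divide_nonneg_pos)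
      finally show "norm (?P c (X z)) \<le> M" .
    qed
    \<comment> \<open>Coefficient families are functions on an infinite type, so compactness is that
      of a product; entries outside the index set are pinned to 0. The absolute value is there
      because no sign of K is assumed.\<close>
    define S where "S = PiE UNIV (\<lambda>\<beta>. if \<beta> \<in> ?I then cball (0::'k) \<bar>K \<beta> * M\<bar> else {0})"
    have "compact S" unfolding S_def by (intro compact_PiE_UNIV) auto
    moreover have S0: "(\<lambda>_. 0) \<in> S" by (simp add: S_def PiE_iff)
    moreover have "continuous_on S (\<lambda>c. E (?P c))"
      unfolding E_def poly_fun_def
      by (intro continuous_intros continuous_on_subset[OF continuous_on_product_coordinates]) auto
    ultimately obtain c where c: "c \<in> S" "\<And>d. d \<in> S \<Longrightarrow> E (?P c) \<le> E (?P d)"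
      using continuous_attains_inf[of S "\<lambda>c. E (?P c)"] by blast
    have "E (?P c) \<le> E (?P d)" for d
    \<comment> \<open>A competitor no worse than 0 lies in S once its irrelevant coefficients are
      cleared; any other one loses to 0, which is in S.\<close>
    proof (cases "E (?P d) \<le> E0")
      case True
      define d' where "d' \<beta> = (if \<beta> \<in> ?I then d \<beta> else 0)" for \<beta>
      have "d' \<in> S"
        using bound[OF True] by (force simp: S_def PiE_iff d'_def)
      moreover have "?P d' = ?P d" by (simp add: d'_def poly_fun_def fun_eq_iff)
      ultimately show ?thesis using c(2)[of d'] by simp
    next
      case False
      then show ?thesis using c(2)[OF S0] by (simp add: E0_def)
    qed
    then show ?thesis by blast
  qed
  then obtain c where c: "\<And>d. E (?P c) \<le> E (?P d)" by blast
  have "?P d = ?P c" if d: "E (?P d) \<le> E (?P c)" for d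
  proof -
    define m where "m = (\<lambda>\<alpha>. of_real (1 / 2) * (c \<alpha> + d \<alpha>))"
    have m: "?P m x = (1 / 2) *\<^sub>R (?P c x + ?P d x)" for x
      by (simp only: m_def poly_fun_add poly_fun_cmult scaleR_conv_of_real)
    have "E (?P m) = E (?P c) / 2 + E (?P d) / 2 - (\<Sum>z\<in>Z. \<omega> z * (norm (?P c (X z) - ?P d (X z)))\<^sup>2) / 4"
      unfolding E_def m norm_midpoint_sq
      by (simp add: algebra_simps sum.distrib sum_subtractf sum_divide_distrib)
    then have "(\<Sum>z\<in>Z. \<omega> z * (norm (?P c (X z) - ?P d (X z)))\<^sup>2) \<le> 0"
      using c[of m] d by simp
    moreover have nonneg: "\<omega> z * (norm (?P c (X z) - ?P d (X z)))\<^sup>2 \<ge> 0" if "z \<in> Z" for z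
      using \<omega>[OF that] by simp
    ultimately have "(\<Sum>z\<in>Z. \<omega> z * (norm (?P c (X z) - ?P d (X z)))\<^sup>2) = 0"
      by (intro antisym sum_nonneg) auto
    then have "\<omega> z * (norm (?P c (X z) - ?P d (X z)))\<^sup>2 = 0" if "z \<in> Z" for z
      using sum_nonneg_eq_0_iff[OF Z, of "\<lambda>z. \<omega> z * (norm (?P c (X z) - ?P d (X z)))\<^sup>2"] nonneg that by blast
    then have "norm (?P (\<lambda>\<alpha>. c \<alpha> - d \<alpha>) (X z)) \<le> 0" if "z \<in> Z" for z
      using that \<omega>[OF that] by (fastforce simp flip: poly_fun_diff)
    then have "norm (c \<beta> - d \<beta>) \<le> K \<beta> * 0" if "\<beta> \<in> ?I" for \<beta>
      using unisolvent[of "\<lambda>\<alpha>. c \<alpha> - d \<alpha>" 0] that by blast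
    then show ?thesis by (simp add: poly_fun_def fun_eq_iff)
  qed
  then show ?thesis
    unfolding E_def[symmetric] is_arg_min_def polys
    using c by (intro ex1I[of _ "?P c"]) (auto simp: not_less)
qed

section \<open>Convergence of moving least squares\<close>

text \<open>The point x is lifted to p on the sphere and a node z close to p is taken. Dropping the
  last coordinate is 1-Lipschitz, so the coordinates of z are as close to x as z is to p.\<close>

lemma tangent_nodes_dense:
  fixes x :: "real ^ 'n::finite" and s :: real
  assumes Y: "node_set Y" and A: "rotation_matrix A" "A *v y = north" and y: "norm y = 1"
    and x: "\<And>i. \<bar>x $ i\<bar> \<le> s / 2" and s: "0 \<le> s" "CARD('n) * s \<le> 1"
  obtains z where "z \<in> Y" "norm (sphere_proj_inv (A *v z) - x) \<le> fill_dist Y"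
    "gdist z y \<le> 2 * (fill_dist Y + CARD('n) * s)"
proof -
  have "norm x \<le> (\<Sum>i\<in>UNIV. \<bar>x $ i\<bar>)" by (rule norm_le_l1_cart)
  also have "\<dots> \<le> (\<Sum>i\<in>(UNIV :: 'n set). s / 2)" by (intro sum_mono x)
  finally have nx: "2 * norm x \<le> CARD('n) * s" by simp
  define p where "p = transpose A *v sphere_proj x"
  have Ap: "A *v p = sphere_proj x"
    unfolding p_def by (rule rotation_matrix_transpose_mult(2)[OF A(1)])
  have normA: "norm (u - v) = norm (A *v u - A *v v)" for u v
    by (simp add: norm_rotation_matrix_mult[OF A(1)] flip: matrix_vector_mult_diff_distrib)
  have "norm (A *v p) = 1" unfolding Ap using nx s by (intro norm_sphere_proj) simp
  then have p: "norm p = 1" by (simp add: norm_rotation_matrix_mult[OF A(1)])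
  obtain z where z: "z \<in> Y" "gdist z p \<le> fill_dist Y" using node_near[OF Y p] by blast
  have nz: "norm z = 1" using z Y by (auto simp: node_set_def)
  have zp: "norm (z - p) \<le> fill_dist Y" using norm_diff_le_gdist[OF nz p] z(2) by simp
  have "norm (p - y) \<le> 2 * norm x"
    unfolding normA[of p y] Ap A(2) using nx s by (intro norm_sphere_proj_minus_north_le) simp
  then have "norm (z - y) \<le> fill_dist Y + CARD('n) * s"
    using zp nx norm_triangle_ineq[of "z - p" "p - y"] by simp
  then have "gdist z y \<le> 2 * (fill_dist Y + CARD('n) * s)"
    using gdist_le_norm_diff[OF nz y] by simp
  moreover have "norm (sphere_proj_inv (A *v z) - x) \<le> norm (A *v z - sphere_proj x)"
    using norm_sphere_proj_inv_le[of "A *v z - sphere_proj x"] by (simp add: sphere_proj_inv_diff)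
  then have "norm (sphere_proj_inv (A *v z) - x) \<le> fill_dist Y"
    using zp normA[of z p] by (simp add: Ap)
  ultimately show thesis using that z(1) by blast
qed

text \<open>Chordal distance at most 1 from \<open>north\<close> makes the last coordinate
  nonnegative, so \<open>sphere_proj\<close> recovers the point from its coordinates.\<close>

lemma tangent_coordinates:
  assumes A: "rotation_matrix A" "A *v y = north" and n: "norm y = 1" "norm z = 1" and "gdist z y \<le> 1"
  shows "norm (sphere_proj_inv (A *v z)) \<le> gdist z y"
    and "transpose A *v sphere_proj (sphere_proj_inv (A *v z)) = z"
proof -
  have "norm (A *v z - north) = norm (z - y)"
    using norm_rotation_matrix_mult[OF A(1), of "z - y"] A(2) by (simp add: matrix_vector_mult_diff_distrib)
  then have *: "norm (A *v z - north) \<le> gdist z y"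
    using norm_diff_le_gdist[OF n(2,1)] by simp
  then show "norm (sphere_proj_inv (A *v z)) \<le> gdist z y"
    using norm_sphere_proj_inv_le_dist_north[of "A *v z"] by simp
  have "\<bar>(A *v z - north) $ None\<bar> \<le> 1"
    using * assms(5) component_le_norm_cart[of "A *v z - north" None] by simp
  moreover have "(north :: 'a ambient) $ None = 1" by (simp add: north_def axis_def)
  ultimately have "(A *v z) $ None \<ge> 0" unfolding vector_minus_component by linarith
  then have "sphere_proj (sphere_proj_inv (A *v z)) = A *v z"
    using n(2) by (intro sphere_proj_sphere_proj_inv) (simp_all add: norm_rotation_matrix_mult[OF A(1)])
  then show "transpose A *v sphere_proj (sphere_proj_inv (A *v z)) = z"
    using rotation_matrix_transpose_mult(1)[OF A(1)] by simp
qed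

text \<open>The estimate at one centre, with the geometry turned into hypotheses. Only the nodes of
  Y' have weights bounded below; the other nodes enter through the error of the competitor t. K
  depends on \<beta> because scaled norming divides by a power of s, but p 0 and t 0 are constant
  coefficients, so only its value at 0 appears.\<close>

lemma mls_pointwise:
  fixes f :: "'n::finite ambient \<Rightarrow> 'k::{real_normed_field, euclidean_space}"
    and A :: "real ^ ('n option) ^ ('n option)"
  defines "X \<equiv> \<lambda>z. sphere_proj_inv (A *v z)"
  assumes fin: "finite Y" and w: "\<And>z. z \<in> Y \<Longrightarrow> 0 \<le> w z y \<and> w z y \<le> W"
    and supp: "\<And>z. z \<in> Y \<Longrightarrow> w z y > 0 \<Longrightarrow> z \<in> cap y (pi / 2)"
    and near: "Y' \<subseteq> Y" "\<And>z. z \<in> Y' \<Longrightarrow> \<mu> \<le> w z y" and \<mu>: "\<mu> > 0"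
    and card: "card {z \<in> Y. w z y > 0} \<le> N"
    and K: "\<And>\<beta>. K \<beta> \<ge> 0"
    and unisolvent: "\<And>c M \<beta>. (\<And>z. z \<in> Y' \<Longrightarrow> norm (poly_fun (Suc L) c (X z) :: 'k) \<le> M) \<Longrightarrow>
        \<beta> \<in> multi_idx (Suc L) \<Longrightarrow> norm (c \<beta>) \<le> K \<beta> * M"
    and T: "\<And>z. z \<in> Y \<Longrightarrow> w z y > 0 \<Longrightarrow> norm (f z - poly_fun (Suc L) t (X z)) \<le> \<tau>"
      "f y = poly_fun (Suc L) t 0"
    and \<tau>: "\<tau> \<ge> 0"
  shows "mls_defined L f Y w A y \<and>
    norm (f y - mls L f Y w A y) \<le> K (\<lambda>_. 0) * ((sqrt (N * W / \<mu>) + 1) * \<tau>)"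
proof
  let ?P = "poly_fun (Suc L) :: (('n \<Rightarrow> nat) \<Rightarrow> 'k) \<Rightarrow> real ^ 'n \<Rightarrow> 'k"
  define Z where "Z = {z \<in> Y. w z y > 0}"
  define E where "E p = (\<Sum>z\<in>Z. w z y * (norm (f z - p (X z)))\<^sup>2)" for p
  have E: "mls_error f Y w A y = E"
    by (simp add: fun_eq_iff mls_error_def E_def Z_def X_def)
  have Y': "Y' \<subseteq> Z" using near \<mu> by (force simp: Z_def)
  have Z: "finite Z" using fin by (simp add: Z_def)
  have "\<exists>!p. is_arg_min (\<lambda>p. \<Sum>z\<in>Z. w z y * (norm (f z - p (X z)))\<^sup>2) (\<lambda>p. p \<in> polys L) p"
  proof (rule least_squares_unique_solution[OF Z])
    show "w z y > 0" if "z \<in> Z" for z using that by (simp add: Z_def)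
    show "norm (c \<beta>) \<le> K \<beta> * M"
      if "\<And>z. z \<in> Z \<Longrightarrow> norm (?P c (X z)) \<le> M" "\<beta> \<in> multi_idx (Suc L)" for c M \<beta>
      using that Y' by (intro unisolvent) auto
  qed
  then have ex1: "\<exists>!p. mls_minimizer L f Y w A y p"
    unfolding mls_minimizer_def E E_def [abs_def] .
  then show "mls_defined L f Y w A y"
    using supp by (simp add: mls_defined_def)
  define p where "p = (THE p. mls_minimizer L f Y w A y p)"
  have "mls_minimizer L f Y w A y p" unfolding p_def using ex1 by (rule theI')
  then have min: "p \<in> polys L" "\<And>q. q \<in> polys L \<Longrightarrow> E p \<le> E q"
    unfolding mls_minimizer_def E is_arg_min_def by (auto simp: not_less)
  then obtain c where c: "p = ?P c" using polys_iff by blast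
  have W: "W \<ge> 0" if "z \<in> Y" for z using w[OF that] by linarith
  have "E (?P t) \<le> (\<Sum>z\<in>Z. W * \<tau>\<^sup>2)"
    unfolding E_def using w T(1) W by (intro sum_mono mult_mono power_mono) (auto simp: Z_def)
  also have "\<dots> = card Z * (W * \<tau>\<^sup>2)" by simp
  finally have EP: "E p \<le> card Z * (W * \<tau>\<^sup>2)"
    using min(2)[of "?P t"] polys_iff by (metis order_trans)
  have "norm (c (\<lambda>_. 0) - t (\<lambda>_. 0)) \<le> K (\<lambda>_. 0) * ((sqrt (N * W / \<mu>) + 1) * \<tau>)"
  proof (rule unisolvent)
    show "(\<lambda>_. 0) \<in> (multi_idx (Suc L) :: ('n \<Rightarrow> nat) set)" by (simp add: multi_idx_def)
    fix z assume z: "z \<in> Y'"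
    then have zZ: "z \<in> Z" "z \<in> Y" "w z y > 0" using Y' by (auto simp: Z_def)
    \<comment> \<open>A single term is bounded by the minimal error, which is at most that of
      t.\<close>
    have "\<mu> * (norm (f z - p (X z)))\<^sup>2 \<le> w z y * (norm (f z - p (X z)))\<^sup>2"
      using near(2)[OF z] by (intro mult_right_mono) auto
    also have "\<dots> \<le> E p"
      unfolding E_def using Z zZ
      by (intro member_le_sum[of z Z "\<lambda>z. w z y * (norm (f z - p (X z)))\<^sup>2"] mult_nonneg_nonneg) (auto simp: Z_def)
    also have "\<dots> \<le> N * (W * \<tau>\<^sup>2)"
      using card W[OF zZ(2)] by (intro order_trans[OF EP] mult_right_mono) (auto simp: Z_def)
    finally have "(norm (f z - p (X z)))\<^sup>2 \<le> (N * W / \<mu>) * \<tau>\<^sup>2"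
      using \<mu> by (simp add: field_simps)
    then have "norm (f z - p (X z)) \<le> sqrt (N * W / \<mu> * \<tau>\<^sup>2)" by (rule real_le_rsqrt)
    then have "norm (f z - p (X z)) \<le> sqrt (N * W / \<mu>) * \<tau>" using \<tau> by (simp only: real_sqrt_mult real_sqrt_abs abs_of_nonneg)
    moreover have "norm (f z - ?P t (X z)) \<le> \<tau>" using T zZ by blast
    moreover have "?P (\<lambda>\<alpha>. c \<alpha> - t \<alpha>) (X z) = (f z - ?P t (X z)) - (f z - p (X z))"
      by (simp add: c flip: poly_fun_diff)
    ultimately show "norm (?P (\<lambda>\<alpha>. c \<alpha> - t \<alpha>) (X z)) \<le> (sqrt (N * W / \<mu>) + 1) * \<tau>"
      using norm_triangle_ineq4[of "f z - ?P t (X z)" "f z - p (X z)"] by (simp add: ring_distribs)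
  qed
  moreover have "mls L f Y w A y = c (\<lambda>_. 0)"
    by (simp add: mls_def flip: p_def) (simp add: c poly_fun_zero)
  ultimately show "norm (f y - mls L f Y w A y) \<le> K (\<lambda>_. 0) * ((sqrt (N * W / \<mu>) + 1) * \<tau>)"
    using T(2) by (simp add: poly_fun_zero norm_minus_commute)
qed

text \<open>Stated for one scalar type. The order of choices matters: \<eta>, K, \<mu>, W and r are
  fixed before f, c, R and the nodes; C and N come afterwards, and D collects the constants without
  reference to l or y.\<close>

lemma mls_rate:
  fixes \<phi> :: "real \<Rightarrow> real"
  assumes cont: "continuous_on {0..} \<phi>" and nonneg: "\<forall>t\<ge>0. \<phi> t \<ge> 0"
    and pos: "\<forall>t\<in>{0..1 / 2}. \<phi> t > 0" and zero: "\<forall>t\<ge>1. \<phi> t = 0"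
  shows "\<exists>r>0. \<forall>(c::real) (Y :: nat \<Rightarrow> 'n::finite ambient set) (R::real) Rot.
    c > 0 \<longrightarrow> (\<forall>l. node_set (Y l)) \<longrightarrow> (\<forall>l. fill_dist (Y l) / sep_dist (Y l) \<le> c) \<longrightarrow>
    (\<lambda>l. fill_dist (Y l)) \<longlonglongrightarrow> 0 \<longrightarrow> R \<ge> r \<longrightarrow> rotation_field Rot \<longrightarrow>
    (\<forall>f :: 'n ambient \<Rightarrow> 'k::{real_normed_field, euclidean_space}. Ck_sphere (L + 1) f \<longrightarrow>
       mls_converges_with_rate L f Y (\<lambda>l y z. \<phi> (gdist y z / (R * fill_dist (Y l)))) Rot
         (\<lambda>l. fill_dist (Y l) ^ (L + 1)))"
proof -
  obtain \<eta> K :: real where \<eta>: "0 < \<eta>" "\<eta> \<le> 1 / 2" and K: "K > 0" and norming: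
    "\<And>s (c :: ('n \<Rightarrow> nat) \<Rightarrow> 'k) M Z \<beta>. s > 0 \<Longrightarrow>
      (\<And>x. (\<And>i. \<bar>x $ i\<bar> \<le> s / 2) \<Longrightarrow> \<exists>z\<in>Z. norm (z - x) \<le> \<eta> * s) \<Longrightarrow>
      (\<And>z. z \<in> Z \<Longrightarrow> (\<And>i. \<bar>z $ i\<bar> \<le> s) \<Longrightarrow> norm (poly_fun (Suc L) c z) \<le> M) \<Longrightarrow>
      \<beta> \<in> multi_idx (Suc L) \<Longrightarrow> norm (c \<beta>) * s ^ sum \<beta> UNIV \<le> K * M"
    by (fact norming_set_scaled)
  have cont01: "continuous_on {0..1} \<phi>" "continuous_on {0..1/2} \<phi>"
    using cont by (auto intro: continuous_on_subset)
  obtain t0 where t0: "t0 \<in> {0..1/2}" "\<And>t. t \<in> {0..1/2} \<Longrightarrow> \<phi> t0 \<le> \<phi> t"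
    using continuous_attains_inf[OF _ _ cont01(2)] by auto
  define \<mu> where "\<mu> = \<phi> t0"
  have \<mu>: "\<mu> > 0" using t0(1) pos by (simp add: \<mu>_def)
  obtain t1 where t1: "t1 \<in> {0..1}" "\<And>t. t \<in> {0..1} \<Longrightarrow> \<phi> t \<le> \<phi> t1"
    using continuous_attains_sup[OF _ _ cont01(1)] by auto
  define W where "W = \<phi> t1"
  have W: "\<phi> t \<le> W" if "t \<ge> 0" for t
  proof (cases "t \<le> 1")
    case True
    then show ?thesis using t1(2)[of t] that by (simp add: W_def)
  next
    case False
    then show ?thesis using zero t1(1) nonneg by (simp add: W_def)
  qed
  define n where "n = real CARD('n)"
  have n: "n \<ge> 1" by (simp add: n_def Suc_leI)
  \<comment> \<open>For s = \<delta> / (8 * n) the mesh condition h \<le> \<eta> * s reads R \<ge> 8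
    * n / \<eta>; this also gives R \<ge> 8.\<close>
  define r where "r = 8 * n / \<eta>"
  have "r \<ge> 8 * 1 / 1" unfolding r_def using \<eta> n by (intro frac_le mult_left_mono) auto
  then have r: "r \<ge> 8" by simp
  show ?thesis
  proof (intro exI[of _ r] conjI allI impI)
    show "r > 0" using r by simp
  next
    fix c :: real and Y :: "nat \<Rightarrow> 'n ambient set" and R :: real and f :: "'n ambient \<Rightarrow> 'k"
      and Rot :: "'n ambient \<Rightarrow> real ^ ('n option) ^ ('n option)"
    assume c: "c > 0" and Y': "\<forall>l. node_set (Y l)"
      and quasi: "\<forall>l. fill_dist (Y l) / sep_dist (Y l) \<le> c"
      and lim: "(\<lambda>l. fill_dist (Y l)) \<longlonglongrightarrow> 0" and R: "R \<ge> r" and Rot: "rotation_field Rot"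
      and f: "Ck_sphere (L + 1) f"
    have Y: "node_set (Y l)" for l using Y' by blast
    define h where "h l = fill_dist (Y l)" for l
    define w where "w l y z = \<phi> (gdist y z / (R * h l))" for l and y z :: "'n ambient"
    have h: "h l > 0" for l using fill_dist_pos[OF Y] by (simp add: h_def)
    have R8: "R \<ge> 8" using R r by simp
    obtain C where C: "C \<ge> 0" and taylor: "\<And>y. y \<in> sphere 0 1 \<Longrightarrow>
      \<exists>c. \<forall>x. norm x \<le> 1 / 8 \<longrightarrow> norm (f (transpose (Rot y) *v sphere_proj x) - poly_fun (Suc L) c x) \<le> C * norm x ^ Suc L"
      using taylor_uniform[OF f Rot] by (metis Suc_eq_plus1)
    have "1 / (R * c) > 0" using R8 c by simp
    then obtain N where N: "\<And>(y :: 'n ambient) \<delta> S. \<delta> > 0 \<Longrightarrow> finite S \<Longrightarrow> (\<And>z. z \<in> S \<Longrightarrow> norm (z - y) \<le> \<delta>) \<Longrightarrow>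
      (\<And>z z'. z \<in> S \<Longrightarrow> z' \<in> S \<Longrightarrow> z \<noteq> z' \<Longrightarrow> 1 / (R * c) * \<delta> \<le> norm (z - z')) \<Longrightarrow> card S \<le> N"
      using packing_bound by blast
    define D where "D = K * ((sqrt (N * W / \<mu>) + 1) * (C * R ^ Suc L))"
    \<comment> \<open>The bound on R * h puts all nodes of positive weight into the range 1 / 8 of
      the Taylor estimate, and well inside the cap of radius pi / 2.\<close>
    have point: "mls_defined L f (Y l) (w l) (Rot y) y \<and>
        norm (f y - mls L f (Y l) (w l) (Rot y) y) \<le> D * h l ^ Suc L"
      if small: "R * h l \<le> 1 / 8" and y: "norm y = 1" for l y
    proof -
      define \<delta> where "\<delta> = R * h l"
      \<comment> \<open>Since h and n * s are both at most \<delta> / 8, the nodes from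
        \<open>tangent_nodes_dense\<close> have distance at most 2 * (h + n * s) \<le> \<delta> / 2
        from y, where the weight is at least \<mu>.\<close>
      define s where "s = \<delta> / (8 * n)"
      define Y' where "Y' = {z \<in> Y l. gdist z y \<le> \<delta> / 2}"
      define X where "X z = sphere_proj_inv (Rot y *v z)" for z
      have \<delta>: "\<delta> > 0" "\<delta> \<le> 1 / 8" using R8 h small by (simp_all add: \<delta>_def)
      have s: "s > 0" "n * s = \<delta> / 8" using \<delta> n by (simp_all add: s_def)
      have "8 * n \<le> R * \<eta>" using R \<eta> by (simp add: r_def field_simps)
      then have "h l * (8 * n) \<le> h l * (R * \<eta>)" using h[of l] by (intro mult_left_mono) auto
      then have hs: "h l \<le> \<eta> * s" using n by (simp add: s_def \<delta>_def field_simps)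
      have "8 * h l \<le> \<delta>" unfolding \<delta>_def using R8 h[of l] by (intro mult_right_mono) auto
      have A: "rotation_matrix (Rot y)" "Rot y *v y = north"
        using Rot y by (auto simp: rotation_field_def)
      have fin: "finite (Y l)" and sph: "\<And>z. z \<in> Y l \<Longrightarrow> norm z = 1"
        using Y[of l] by (auto simp: node_set_def)
      have gd: "gdist z y \<ge> 0" if "z \<in> Y l" for z
        using norm_diff_le_gdist[OF sph[OF that] y] norm_ge_zero order_trans by blast
      have w_pos: "gdist z y < \<delta>" if "w l z y > 0" for z
      proof (rule ccontr)
        assume "\<not> gdist z y < \<delta>"
        then have "gdist z y / \<delta> \<ge> 1" using \<delta> by simp
        then show False using zero that by (simp add: w_def \<delta>_def)
      qed
      have unisolvent: "norm (c \<beta>) \<le> K / s ^ sum \<beta> UNIV * M"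
        if M: "\<And>z. z \<in> Y' \<Longrightarrow> norm (poly_fun (Suc L) c (X z)) \<le> M" and \<beta>: "\<beta> \<in> multi_idx (Suc L)"
        for c :: "('n \<Rightarrow> nat) \<Rightarrow> 'k" and M \<beta>
      proof -
        have "norm (c \<beta>) * s ^ sum \<beta> UNIV \<le> K * M"
        proof (rule norming[OF s(1) _ _ \<beta>])
          fix x :: "real ^ 'n" assume x: "\<And>i. \<bar>x $ i\<bar> \<le> s / 2"
          have "0 \<le> s" "CARD('n) * s \<le> 1" using s \<delta> by (simp_all add: n_def)
          from tangent_nodes_dense[OF Y A y x this] obtain z where z: "z \<in> Y l"
            "norm (X z - x) \<le> h l" "gdist z y \<le> 2 * (h l + n * s)"
            unfolding X_def h_def n_def by blast
          have "z \<in> Y'" using z(1,3) s(2) \<open>8 * h l \<le> \<delta>\<close> by (simp add: Y'_def)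
          then show "\<exists>z\<in>X ` Y'. norm (z - x) \<le> \<eta> * s" using z(2) hs by force
        next
          fix u assume "u \<in> X ` Y'"
          then show "norm (poly_fun (Suc L) c u) \<le> M" using M by blast
        qed
        then show ?thesis using s(1) by (simp add: field_simps)
      qed
      obtain t where t: "\<And>x. norm x \<le> 1 / 8 \<Longrightarrow>
          norm (f (transpose (Rot y) *v sphere_proj x) - poly_fun (Suc L) t x) \<le> C * norm x ^ Suc L"
        using taylor[of y] y by auto
      have T: "norm (f z - poly_fun (Suc L) t (X z)) \<le> C * \<delta> ^ Suc L" if z: "z \<in> Y l" "w l z y > 0" for z
      proof -
        have "gdist z y \<le> 1" using w_pos[OF z(2)] \<delta> by simp
        note X = tangent_coordinates[OF A y sph[OF z(1)] this]
        have "norm (X z) \<le> \<delta>" using X(1) w_pos[OF z(2)] by (simp add: X_def)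
        moreover have "f (transpose (Rot y) *v sphere_proj (X z)) = f z"
          unfolding X_def X(2) ..
        moreover have "C * norm (X z) ^ Suc L \<le> C * \<delta> ^ Suc L"
          using \<open>norm (X z) \<le> \<delta>\<close> C by (intro mult_left_mono power_mono) auto
        ultimately show ?thesis using t[of "X z"] \<delta> by simp
      qed
      \<comment> \<open>At x = 0 the remainder bound vanishes, because its exponent is
        positive.\<close>
      have ty: "f y = poly_fun (Suc L) t 0"
      proof -
        have "transpose (Rot y) *v sphere_proj 0 = y"
          using rotation_matrix_transpose_mult(1)[OF A(1), of y] by (simp only: A(2) sphere_proj_0)
        then show ?thesis using t[of 0] by simp
      qed
      have card: "card {z \<in> Y l. w l z y > 0} \<le> N"
      proof (rule N[OF \<delta>(1)])
        show "norm (z - y) \<le> \<delta>" if "z \<in> {z \<in> Y l. w l z y > 0}" for z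
          using norm_diff_le_gdist[OF sph y, of z] w_pos[of z] that by auto
        show "1 / (R * c) * \<delta> \<le> norm (z - z')"
          if "z \<in> {z \<in> Y l. w l z y > 0}" "z' \<in> {z \<in> Y l. w l z y > 0}" "z \<noteq> z'" for z z'
        proof -
          have z: "z \<in> Y l" "z' \<in> Y l" using that by auto
          \<comment> \<open>Quasi-uniformity enters only here: h / c is at most the separation
            distance, hence at most half the arc and so at most the chord.\<close>
          have "1 / (R * c) * \<delta> = h l / c" using R8 by (simp add: \<delta>_def)
          also have "\<dots> \<le> sep_dist (Y l)"
            using spec[OF quasi, of l] sep_dist_pos[OF Y[of l]] c by (simp add: h_def field_simps)
          also have "\<dots> \<le> gdist z z' / 2" using sep_dist_le[OF Y z that(3)] by simp
          also have "\<dots> \<le> norm (z - z')" using gdist_le_norm_diff[OF sph sph, OF z] by simp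
          finally show ?thesis .
        qed
      qed (use fin in simp)
      have near: "\<mu> \<le> w l z y" if "z \<in> Y'" for z
        using that gd \<delta> unfolding w_def \<mu>_def \<delta>_def[symmetric] by (intro t0(2)) (auto simp: Y'_def field_simps)
      have cap: "z \<in> cap y (pi / 2)" if "z \<in> Y l" "w l z y > 0" for z
        using sph[OF that(1)] w_pos[OF that(2)] \<delta> pi_ge_two by (simp add: cap_def gdist_commute[of y])
      have wW: "0 \<le> w l z y \<and> w l z y \<le> W" if "z \<in> Y l" for z
      proof -
        have "gdist z y / \<delta> \<ge> 0" using gd[OF that] \<delta> by simp
        then show ?thesis unfolding w_def \<delta>_def[symmetric] using W nonneg by blast
      qed
      have "Y' \<subseteq> Y l" by (auto simp: Y'_def)
      have K0: "K / s ^ sum \<beta> UNIV \<ge> 0" for \<beta> :: "'n \<Rightarrow> nat" using K s(1) by simp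
      have \<tau>: "C * \<delta> ^ Suc L \<ge> 0" using C \<delta> by simp
      have mls: "mls_defined L f (Y l) (w l) (Rot y) y \<and>
          norm (f y - mls L f (Y l) (w l) (Rot y) y) \<le>
          K / s ^ sum (\<lambda>_ :: 'n. 0) UNIV * ((sqrt (N * W / \<mu>) + 1) * (C * \<delta> ^ Suc L))"
      proof (rule mls_pointwise[where K = "\<lambda>\<beta>. K / s ^ sum \<beta> UNIV" and Y' = Y' and \<mu> = \<mu> and W = W
            and N = N and t = t and \<tau> = "C * \<delta> ^ Suc L"])
        fix c :: "('n \<Rightarrow> nat) \<Rightarrow> 'k" and M and \<beta> :: "'n \<Rightarrow> nat"
        assume "\<And>z. z \<in> Y' \<Longrightarrow> norm (poly_fun (Suc L) c (sphere_proj_inv (Rot y *v z))) \<le> M"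
          and "\<beta> \<in> multi_idx (Suc L)"
        then show "norm (c \<beta>) \<le> K / s ^ sum \<beta> UNIV * M"
          by (rule unisolvent[unfolded X_def])
      qed (fact fin wW cap \<open>Y' \<subseteq> Y l\<close> near \<mu> card K0 T[unfolded X_def] ty \<tau>)+
      have "norm (f y - mls L f (Y l) (w l) (Rot y) y) \<le> K / s ^ sum (\<lambda>_ :: 'n. 0) UNIV * ((sqrt (N * W / \<mu>) + 1) * (C * \<delta> ^ Suc L))"
        using mls by blast
      \<comment> \<open>The zero multi-index gives s ^ 0 = 1, so the radius s drops out and \<delta>
        = R * h leaves the pure power of h.\<close>
      also have "\<dots> = D * h l ^ Suc L"
        by (simp add: D_def \<delta>_def power_mult_distrib mult_ac)
      finally show ?thesis using mls by blast
    qed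
    have "((\<lambda>l. R * h l) \<longlongrightarrow> R * 0) sequentially"
      using lim unfolding h_def by (intro tendsto_intros)
    then have small: "\<forall>\<^sub>F l in sequentially. R * h l < 1 / 8"
      by (rule order_tendstoD) simp
    let ?e = "\<lambda>l y. f y - mls L f (Y l) (w l) (Rot y) y"
    have "\<forall>\<^sub>F l in sequentially. (\<forall>y\<in>sphere 0 1. mls_defined L f (Y l) (w l) (Rot y) y) \<and> sphere_bounded (?e l)"
      using small
    proof eventually_elim
      case (elim l)
      have "bounded (?e l ` sphere 0 1)"
        using point[of l] elim by (intro boundedI[of _ "D * h l ^ Suc L"]) auto
      then show ?case using point[of l] elim by (auto simp: sphere_bounded_def)
    qed
    moreover have "(\<lambda>l. sphere_sup_norm (?e l)) \<in> O(\<lambda>l. h l ^ (L + 1))"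
    proof (rule bigoI)
      show "\<forall>\<^sub>F l in sequentially. norm (sphere_sup_norm (?e l)) \<le> D * norm (h l ^ (L + 1))"
        using small
      proof eventually_elim
        case (elim l)
        have le: "norm (?e l y) \<le> D * h l ^ Suc L" if "y \<in> sphere 0 1" for y
          using point[of l y] elim that by simp
        \<comment> \<open>For the real supremum a nonempty sphere and the bound \<open>le\<close>
          are both needed, also to see that it is nonnegative.\<close>
        have ne: "sphere 0 1 \<noteq> ({} :: 'n ambient set)" using infinite_sphere by fastforce
        then obtain y :: "'n ambient" where y: "y \<in> sphere 0 1" by blast
        have "norm (?e l y) \<le> sphere_sup_norm (?e l)"
          unfolding sphere_sup_norm_def by (intro cSUP_upper y bdd_aboveI2[OF le])
        then have "0 \<le> sphere_sup_norm (?e l)" by (rule order_trans[OF norm_ge_zero])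
        moreover have "sphere_sup_norm (?e l) \<le> D * h l ^ Suc L"
          unfolding sphere_sup_norm_def by (intro cSUP_least ne le)
        ultimately show ?case using h[of l] by simp
      qed
    qed
    ultimately show "mls_converges_with_rate L f Y (\<lambda>l y z. \<phi> (gdist y z / (R * fill_dist (Y l)))) Rot
         (\<lambda>l. fill_dist (Y l) ^ (L + 1))"
      unfolding mls_converges_with_rate_def w_def h_def by blast
  qed
qed

theorem corollary5p4:
  fixes L :: nat and \<phi> :: "real \<Rightarrow> real"
  assumes "continuous_on {0..} \<phi>"
    and "\<And>t. t \<ge> 0 \<Longrightarrow> \<phi> t \<ge> 0"
    and "\<And>t. 0 \<le> t \<Longrightarrow> t \<le> 1 / 2 \<Longrightarrow> \<phi> t > 0"
    and "\<And>t. t \<ge> 1 \<Longrightarrow> \<phi> t = 0"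
  shows "\<exists>r>0. \<forall>(c::real) (Y :: nat \<Rightarrow> 'n::finite ambient set) (R::real) Rot.
    c > 0 \<longrightarrow>
    (\<forall>l. node_set (Y l)) \<longrightarrow>
    (\<forall>l. fill_dist (Y l) / sep_dist (Y l) \<le> c) \<longrightarrow>
    (\<lambda>l. fill_dist (Y l)) \<longlonglongrightarrow> 0 \<longrightarrow>
    R \<ge> r \<longrightarrow>
    rotation_field Rot \<longrightarrow>
    (let w = (\<lambda>l y z. \<phi> (gdist y z / (R * fill_dist (Y l))));
         \<rho> = (\<lambda>l. fill_dist (Y l) ^ (L + 1))
     in (\<forall>f :: 'n ambient \<Rightarrow> real.
           Ck_sphere (L + 1) f \<longrightarrow> mls_converges_with_rate L f Y w Rot \<rho>) \<and>
        (\<forall>f :: 'n ambient \<Rightarrow> complex.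
           Ck_sphere (L + 1) f \<longrightarrow> mls_converges_with_rate L f Y w Rot \<rho>))"
proof -
  have "\<forall>t\<ge>0. \<phi> t \<ge> 0" "\<forall>t\<in>{0..1 / 2}. \<phi> t > 0" "\<forall>t\<ge>1. \<phi> t = 0"
    using assms by auto
  note rate = mls_rate[OF assms(1) this, where L = L and 'n = 'n]
  \<comment> \<open>The norming constants may depend on the scalar field; the larger of the two
    thresholds serves both.\<close>
  from rate[where 'k = real] rate[where 'k = complex] show ?thesis
    unfolding Let_def
  proof (elim exE conjE, goal_cases)
    case (1 r r')
    then show ?case
      by (intro exI[of _ "max r r'"]) simp
  qed
qed

end
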